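(* Let $A>2$ and $B\geqslant 3$ be real numbers. Let $n\geqslant 3$ be an integer such that every prime dividing $n$ is at least $B$, and such that $n$ is not a prime power. Let $S\supset\mathbb{Z}/n\mathbb{Z}$ be a cyclic $\mathbb{Z}/n\mathbb{Z}$-algebra of dimension $d$, and let $\sigma$ be a generator of its Galois group $\mathcal{G}$. Assume that $n$ has a prime power divisor $p^v$ (with $p$ prime, $v\geqslant1$) satisfying \[v\log p\geqslant \frac{A\log n}{d}.\] Then the density \[\mu_S=\frac{\#\{x\in S^*\mid \sigma(x)=x^n\}}{\# S^*}\] satisfies \[\mu_S\leqslant p^{-\frac{vd}{2}\left(1-\frac{2}{A}-\frac{4}{B}\right)}\leqslant n^{-\frac{A}{2}\left(1-\frac{2}{A}-\frac{4}{B}\right)}.\]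
   Context: $\log$ is the natural logarithm; $S^*$ is the group of units of $S$. Let $R$ be a commutative ring. A cyclic extension (cyclic $R$-algebra) of $R$ is a commutative $R$-algebra $S$ together with a finite cyclic group $\mathcal{G}$ of $R$-algebra automorphisms of $S$ such that $S$ is a Galois extension of $R$ with group $\mathcal{G}$, i.e. the subring of $\mathcal{G}$-invariants is $S^{\mathcal{G}}=R$ and, for every $\tau\in\mathcal{G}$ with $\tau\neq \mathrm{id}$ and every maximal ideal $\mathfrak{m}$ of $S$, there exists $s\in S$ with $\tau(s)-s\notin\mathfrak{m}$. Such an $S$ (for $R=\mathbb{Z}/n\mathbb{Z}$) is a free $R$-module of rank equal to $\#\mathcal{G}$; this rank $d$ is called its dimension (or degree).
   Formalization: The second inequality (p-power bound ≤ n-power bound) is asserted only when 1−2/A−4/B ≥ 0, as it fails for negative values (e.g. A=B=3, n=15, p=3, v=1, d=10); both upper bounds on μ_S are proved without this restriction. *)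

theory Defs
  imports
    Complex_Main
    "HOL-Algebra.Algebra"
    "HOL-Number_Theory.Number_Theory"
begin

hide_const (open) Divisibility.prime

text \<open>Automorphisms are extensional functions on the carrier, so that their composition and
  identity are those of \<^const>\<open>BijGroup\<close>.\<close>

definition algebra_auts ::
  "('r, 'm) ring_scheme \<Rightarrow> ('r, 's, 'k) module_scheme \<Rightarrow> ('s \<Rightarrow> 's) set" where
  "algebra_auts R S =
     {\<tau> \<in> Bij (carrier S). \<tau> \<in> ring_hom S S \<and>
        (\<forall>r\<in>carrier R. \<forall>x\<in>carrier S. \<tau> (r \<odot>\<^bsub>S\<^esub> x) = r \<odot>\<^bsub>S\<^esub> \<tau> x)}"

definition invariants :: "('s, 'k) ring_scheme \<Rightarrow> ('s \<Rightarrow> 's) set \<Rightarrow> 's set" where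
  "invariants S G = {x \<in> carrier S. \<forall>\<tau>\<in>G. \<tau> x = x}"

text \<open>The invariants being \<open>R\<close> means that the structure map \<open>r \<mapsto> r \<cdot> 1\<close> is a
  bijection from \<open>R\<close> onto them; in particular \<open>R\<close> embeds into \<open>S\<close>.\<close>

definition galois_extension ::
  "('r, 'm) ring_scheme \<Rightarrow> ('r, 's, 'k) module_scheme \<Rightarrow> ('s \<Rightarrow> 's) set \<Rightarrow> bool" where
  "galois_extension R S G \<longleftrightarrow>
     Module.algebra R S \<and>
     subgroup G (BijGroup (carrier S)) \<and> finite G \<and> G \<subseteq> algebra_auts R S \<and>
     bij_betw (\<lambda>r. r \<odot>\<^bsub>S\<^esub> \<one>\<^bsub>S\<^esub>) (carrier R) (invariants S G) \<and>
     (\<forall>\<tau>\<in>G. \<tau> \<noteq> \<one>\<^bsub>BijGroup (carrier S)\<^esub> \<longrightarrow>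
        (\<forall>M. maximalideal M S \<longrightarrow> (\<exists>s\<in>carrier S. \<tau> s \<ominus>\<^bsub>S\<^esub> s \<notin> M)))"

definition cyclic_extension ::
  "('r, 'm) ring_scheme \<Rightarrow> ('r, 's, 'k) module_scheme \<Rightarrow> ('s \<Rightarrow> 's) set \<Rightarrow> bool" where
  "cyclic_extension R S G \<longleftrightarrow>
     galois_extension R S G \<and> cyclic_group ((BijGroup (carrier S))\<lparr>carrier := G\<rparr>)"

definition free_of_rank ::
  "('r, 'm) ring_scheme \<Rightarrow> ('r, 's, 'k) module_scheme \<Rightarrow> nat \<Rightarrow> bool" where
  "free_of_rank R S d \<longleftrightarrow>
     (\<exists>b \<in> {..<d} \<rightarrow> carrier S. \<forall>x\<in>carrier S.
        \<exists>!a. a \<in> {..<d} \<rightarrow>\<^sub>E carrier R \<and> x = (\<Oplus>\<^bsub>S\<^esub>i\<in>{..<d}. a i \<odot>\<^bsub>S\<^esub> b i))"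

definition power_density :: "('s, 'k) ring_scheme \<Rightarrow> ('s \<Rightarrow> 's) \<Rightarrow> nat \<Rightarrow> real" where
  "power_density S \<sigma> n =
     real (card {x \<in> Units S. \<sigma> x = x [^]\<^bsub>S\<^esub> n}) / real (card (Units S))"

end

theory Submission
  imports Defs
begin

text \<open>
  Write \<open>q = p ^ v\<close>. Units of \<open>S / q S\<close> lift to units of \<open>S\<close>, so the density is at most that of
  the solutions of \<open>\<sigma> x = x ^ n\<close> among the units of \<open>S / q S\<close>, and there are at least
  \<open>q ^ d (1 - 1 / p) ^ d\<close> such units, because at most \<open>d\<close> maximal ideals contain \<open>p\<close>.

  Let \<open>M\<close> be one of these maximal ideals. Solutions are determined by their image in the residue
  field \<open>k = S / M\<close>: if a solution \<open>x\<close> is \<open>1\<close> modulo \<open>M\<close>, then \<open>y = x - 1\<close> lies in the largest \<open>\<sigma>\<close>-stable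
  ideal \<open>J\<close> inside \<open>M\<close>, which is nil modulo \<open>q\<close> since \<open>\<sigma>\<close>-invariant idempotents come from
  \<open>\<int> / n\<close>. As \<open>\<sigma>\<close> has finite order, \<open>x = x ^ N\<close> modulo \<open>q\<close> for some power \<open>N\<close> of \<open>n\<close>, which reads
  \<open>y (1 - s) = 0\<close> with \<open>s \<in> J\<close>; hence \<open>y = 0\<close> modulo \<open>q\<close>.

  If \<open>\<sigma> M \<noteq> M\<close>, then \<open>k\<close> has at most \<open>p ^ (d / 2)\<close> elements. Otherwise \<open>\<sigma>\<close> acts on \<open>k\<close>, a field with
  \<open>p ^ f\<close> elements, as \<open>t \<mapsto> t ^ (p ^ a)\<close> with \<open>a < f\<close>, and every image \<open>t\<close> of a solution satisfies
  \<open>t ^ |n - p ^ a| = 1\<close> and \<open>t ^ (n p ^ (f - a) - 1) = 1\<close>. The first exponent is nonzero because \<open>n\<close> is not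
  a prime power. In all cases there are at most \<open>n p ^ (d / 2)\<close> solutions, and \<open>n \<le> p ^ (v d / A)\<close>
  by assumption.
\<close>

text \<open>This infix makes the notation \<open>[k] \<cdot> x\<close> for \<open>k\<close>-fold sums ambiguous.\<close>

no_notation ideal_prod (infixl \<open>\<cdot>\<index>\<close> 80)

section \<open>Finite commutative rings\<close>

text \<open>By the pigeonhole principle the powers of \<open>a\<close> have some period
  \<open>l\<close> from some exponent \<open>i\<close> on. A multiple of \<open>l\<close> that is at
  least \<open>i\<close> may then be doubled as an exponent without changing the power.\<close>

lemma (in monoid) finite_idempotent_power:
  assumes "finite (carrier G)" and a: "a \<in> carrier G"
  shows "\<exists>k>0::nat. a [^] k \<otimes> a [^] k = a [^] k"
proof -
  have "range (\<lambda>i::nat. a [^] i) \<subseteq> carrier G" using a by auto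
  then have "\<not> inj (\<lambda>i::nat. a [^] i)"
    using assms(1) finite_subset range_inj_infinite by blast
  then obtain i j :: nat where "a [^] i = a [^] j" "i \<noteq> j"
    by (auto simp: inj_def)
  then have "\<exists>i l::nat. l > 0 \<and> a [^] (i + l) = a [^] i"
    by (metis less_imp_add_positive linorder_neqE_nat)
  then obtain i l :: nat where l: "l > 0" and il: "a [^] (i + l) = a [^] i" by blast
  have shift: "a [^] (N + l) = a [^] N" if "N \<ge> i" for N
  proof -
    have "a [^] (N + l) = a [^] (N - i) \<otimes> a [^] (i + l)"
      using that a by (simp add: nat_pow_mult)
    also have "\<dots> = a [^] N"
      using that a by (simp add: il nat_pow_mult)
    finally show ?thesis .
  qed
  have period: "a [^] (N + c * l) = a [^] N" if "N \<ge> i" for N c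
  proof (induction c)
    case (Suc c)
    have "a [^] (N + c * l + l) = a [^] (N + c * l)"
      using that by (intro shift) simp
    then show ?case using Suc by (simp add: ac_simps)
  qed simp
  let ?k = "Suc i * l"
  have "?k \<ge> i" using l by (cases l) auto
  then have "a [^] (?k + ?k) = a [^] ?k" by (rule period)
  then show ?thesis using l a by (intro exI[of _ ?k]) (simp add: nat_pow_mult)
qed

context cring
begin

section \<open>Cosets and units modulo an ideal\<close>

lemma coset_eq_iff:
  assumes "ideal I R" "a \<in> carrier R" "b \<in> carrier R"
  shows "I +> a = I +> b \<longleftrightarrow> a \<ominus> b \<in> I"
  using quotient_eq_iff_same_a_r_cos[OF assms] by simp

lemma quotient_hom:
  assumes "ideal I R" shows "ring_hom_cring R (R Quot I) ((+>) I)"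
  using ideal.rcos_ring_hom_cring[OF assms] is_cring by blast

text \<open>The idempotent power \<open>e\<close> of \<open>a\<close> splits the ring into two
  factors. On the factor of \<open>e\<close> the element \<open>a\<close> is invertible and is kept;
  on the other one it is replaced by \<open>\<one>\<close>. As \<open>a\<close> is invertible modulo
  \<open>I\<close>, \<open>e\<close> is \<open>\<one>\<close> modulo \<open>I\<close>, and the
  replacement is invisible there.\<close>

lemma units_lift:
  assumes fin: "finite (carrier R)" and I: "ideal I R"
    and a: "a \<in> carrier R" and b: "b \<in> carrier R" and ab: "a \<otimes> b \<ominus> \<one> \<in> I"
  shows "\<exists>u\<in>Units R. u \<ominus> a \<in> I"
proof -
  interpret h: ring_hom_cring R "R Quot I" "(+>) I" by (rule quotient_hom[OF I])
  obtain k :: nat where k: "k > 0" and idem: "a [^] k \<otimes> a [^] k = a [^] k"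
    using finite_idempotent_power[OF fin a] by auto
  define e where "e = a [^] k"
  \<comment> \<open>Since \<open>a \<otimes> c = e\<close>, this acts as the inverse of
    \<open>a\<close> on the factor of \<open>e\<close>.\<close>
  define c where "c = a [^] (k - 1)"
  have ec [simp]: "e \<in> carrier R" "c \<in> carrier R" and ee: "e \<otimes> e = e"
    using a idem by (auto simp: e_def c_def)
  have ac: "a \<otimes> c = e"
    using k a unfolding e_def c_def
    by (metis Suc_diff_1 m_comm nat_pow_Suc nat_pow_closed)
  have "I +> (a \<otimes> b) = I +> \<one>"
    by (rule coset_eq_iff[OF I, THEN iffD2]) (use a b ab in simp_all)
  then have "I +> ((a \<otimes> b) [^] k) = I +> (\<one> [^] k)"
    using a b h.hom_pow[of "a \<otimes> b" k] h.hom_pow[of \<one> k] by simp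
  then have "I +> (e \<otimes> b [^] k) = I +> \<one>"
    using a b by (simp add: e_def nat_pow_distrib)
  \<comment> \<open>Multiplying by \<open>\<one> \<ominus> e\<close> kills the left side, so
    \<open>\<one> \<ominus> e\<close> vanishes modulo \<open>I\<close>.\<close>
  then have "I +> ((\<one> \<ominus> e) \<otimes> (e \<otimes> b [^] k)) = I +> ((\<one> \<ominus> e) \<otimes> \<one>)"
    using b h.hom_mult[of "\<one> \<ominus> e" "e \<otimes> b [^] k"] h.hom_mult[of "\<one> \<ominus> e" \<one>] by simp
  moreover have "(\<one> \<ominus> e) \<otimes> (e \<otimes> b [^] k) = \<zero>"
  proof -
    have "(\<one> \<ominus> e) \<otimes> (e \<otimes> b [^] k) = (e \<ominus> e \<otimes> e) \<otimes> b [^] k"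
      using ec b nat_pow_closed[of b k] by algebra
    then show ?thesis using b ee ec nat_pow_closed[of b k] by (simp add: r_neg a_minus_def)
  qed
  ultimately have "I +> \<zero> = I +> (\<one> \<ominus> e)" by simp
  then have "\<zero> \<ominus> (\<one> \<ominus> e) \<in> I"
    by (rule coset_eq_iff[OF I, THEN iffD1, rotated 2]) simp_all
  moreover have "\<zero> \<ominus> (\<one> \<ominus> e) = e \<ominus> \<one>" using ec by algebra
  ultimately have e1: "e \<ominus> \<one> \<in> I" by simp
  define u where "u = a \<otimes> e \<oplus> (\<one> \<ominus> e)"
  define u' where "u' = c \<otimes> e \<oplus> (\<one> \<ominus> e)"
  have uc: "u \<in> carrier R" "u' \<in> carrier R" using a by (auto simp: u_def u'_def)
  have "u \<otimes> u' = a \<otimes> c \<otimes> (e \<otimes> e) \<oplus> (a \<oplus> c) \<otimes> (e \<ominus> e \<otimes> e) \<oplus> (\<one> \<ominus> e) \<ominus> (e \<ominus> e \<otimes> e)"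
    unfolding u_def u'_def using a ec by algebra
  also have "\<dots> = \<one>"
    using a ec unfolding ac ee by algebra
  finally have "u \<otimes> u' = \<one>" .
  then have "u \<in> Units R" using uc m_comm[of u u'] by (auto simp: Units_def)
  moreover have "u \<ominus> a = (a \<ominus> \<one>) \<otimes> (e \<ominus> \<one>)"
    unfolding u_def using a ec by algebra
  then have "u \<ominus> a \<in> I" using ideal.I_l_closed[OF I e1] a by simp
  ultimately show ?thesis by blast
qed

section \<open>Prime and maximal ideals of a finite ring, and counting by means of them\<close>

lemma ideal_minus_closed:
  assumes "ideal I R" "x \<in> I" "y \<in> I" shows "x \<ominus> y \<in> I"
  using assms by (simp add: a_minus_def additive_subgroup.a_closed additive_subgroup.a_inv_closed
      ideal.axioms(1))

lemma ideal_add_pow_closed: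
  assumes "ideal I R" "x \<in> I" shows "[(k::nat)] \<cdot> x \<in> I"
proof -
  have "x \<in> carrier R" using assms by (simp add: ideal.Icarr)
  then have "[k] \<cdot> x = ([k] \<cdot> \<one>) \<otimes> x" by (simp add: add_pow_ldistr)
  then show ?thesis using assms by (simp add: ideal.I_l_closed)
qed

text \<open>Only finitely many proper ideals lie above \<open>I\<close>, so one of them is
  maximal.\<close>

lemma maximalideal_containing:
  assumes fin: "finite (carrier R)" and I: "ideal I R" and "\<one> \<notin> I"
  shows "\<exists>M. maximalideal M R \<and> I \<subseteq> M"
proof -
  let ?X = "{J. ideal J R \<and> I \<subseteq> J \<and> \<one> \<notin> J}"
  have sub: "?X \<subseteq> Pow (carrier R)" by (auto dest: ideal.Icarr)
  have "finite ?X" using sub fin by (meson finite_Pow_iff finite_subset)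
  moreover have "I \<in> ?X" using assms by auto
  ultimately have "\<exists>M\<in>?X. I \<subseteq> M \<and> (\<forall>J\<in>?X. M \<subseteq> J \<longrightarrow> M = J)"
    by (rule finite_has_maximal2)
  then obtain M where M: "M \<in> ?X" "I \<subseteq> M" and max: "\<forall>J\<in>?X. M \<subseteq> J \<longrightarrow> M = J" by auto
  have "maximalideal M R"
  proof (rule maximalidealI)
    show "ideal M R" "carrier R \<noteq> M" using M by auto
    fix J assume J: "ideal J R" "M \<subseteq> J" "J \<subseteq> carrier R"
    show "J = M \<or> J = carrier R"
    proof (cases "\<one> \<in> J")
      case True then show ?thesis using ideal.one_imp_carrier[OF J(1)] by simp
    next
      case False then show ?thesis using max J M by auto
    qed
  qed
  then show ?thesis using M by blast
qed

text \<open>A Bezout relation in the natural numbers writes \<open>w\<close> as a difference of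
  multiples of the two given elements. For \<open>i = 0\<close>, coprimality forces
  \<open>j = 1\<close>.\<close>

lemma coprime_add_pow_mem:
  assumes I: "ideal I R" and w: "w \<in> carrier R"
    and "[(i::nat)] \<cdot> w \<in> I" "[(j::nat)] \<cdot> w \<in> I" and "coprime i j"
  shows "w \<in> I"
proof (cases "i = 0")
  case True
  then show ?thesis using assms by auto
next
  case False
  then obtain x y where xy: "i * x = j * y + 1"
    using bezout_nat[of i j] \<open>coprime i j\<close> by auto
  have "[(i * x)] \<cdot> w \<in> I" "[(j * y)] \<cdot> w \<in> I"
    using ideal_add_pow_closed[OF I assms(3), of x] ideal_add_pow_closed[OF I assms(4), of y] w
    by (simp_all add: add.nat_pow_pow)
  then have "[(i * x)] \<cdot> w \<ominus> [(j * y)] \<cdot> w \<in> I"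
    by (rule ideal_minus_closed[OF I])
  moreover have "[(i * x)] \<cdot> w \<ominus> [(j * y)] \<cdot> w = w"
  proof -
    have "[(j * y + 1)] \<cdot> w = [(j * y)] \<cdot> w \<oplus> w" using w by simp
    then show ?thesis unfolding xy using w add.nat_pow_closed[OF w, of "j * y"] by algebra
  qed
  ultimately show ?thesis by simp
qed

text \<open>The translates of \<open>A \<inter> M\<close> by \<open>[i] \<cdot> w\<close> with
  \<open>i < p\<close> stay in \<open>A\<close> and are pairwise disjoint: an overlap would put
  \<open>[(j - i)] \<cdot> w\<close> into \<open>M\<close>, and since \<open>[p] \<cdot> w\<close>
  lies there too, also \<open>w\<close>.\<close>

lemma card_inter_prime_le:
  assumes fin: "finite (carrier R)" and M: "primeideal M R" and p: "Factorial_Ring.prime (p::nat)"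
    and pM: "[p] \<cdot> \<one> \<in> M" and A: "A \<subseteq> carrier R" and w: "w \<in> carrier R" "w \<notin> M"
    and shift: "\<And>a. a \<in> A \<Longrightarrow> a \<oplus> w \<in> A"
  shows "p * card (A \<inter> M) \<le> card A"
proof -
  have I: "ideal M R" using M by (simp add: primeideal_def)
  have mult: "a \<oplus> [i] \<cdot> w \<in> A" if "a \<in> A" for a and i :: nat
  proof (induction i)
    case 0 then show ?case using that A by auto
  next
    case (Suc i)
    have "a \<oplus> [(Suc i)] \<cdot> w = (a \<oplus> [i] \<cdot> w) \<oplus> w" using that A w by (auto simp: a_assoc)
    then show ?case using shift[OF Suc] by simp
  qed
  have pw: "[p] \<cdot> w \<in> M"
    using ideal.I_l_closed[OF I pM w(1)] w by (simp add: add_pow_rdistr)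
  have le: False
    if "i < j" "j < p" and ab: "a \<in> A \<inter> M" "b \<in> A \<inter> M" and eq: "a \<oplus> [i] \<cdot> w = b \<oplus> [j] \<cdot> w"
    for i j a b
  proof -
    have c: "a \<in> carrier R" "b \<in> carrier R" using ab A by auto
    have "[j] \<cdot> w = [i] \<cdot> w \<oplus> [(j - i)] \<cdot> w" using that w by (simp add: add.nat_pow_mult)
    then have "a \<oplus> [i] \<cdot> w = b \<oplus> ([i] \<cdot> w \<oplus> [(j - i)] \<cdot> w)" using eq by simp
    moreover have "a \<ominus> b = (a \<oplus> [i] \<cdot> w) \<ominus> (b \<oplus> [i] \<cdot> w)"
      using c add.nat_pow_closed[OF w(1), of i] by algebra
    ultimately have "a \<ominus> b = (b \<oplus> ([i] \<cdot> w \<oplus> [(j - i)] \<cdot> w)) \<ominus> (b \<oplus> [i] \<cdot> w)" by simp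
    also have "\<dots> = [(j - i)] \<cdot> w"
      using c add.nat_pow_closed[OF w(1), of i] add.nat_pow_closed[OF w(1), of "j - i"] by algebra
    finally have "[(j - i)] \<cdot> w \<in> M" using ideal_minus_closed[OF I, of a b] ab by simp
    moreover have "coprime (j - i) p"
      using that p by (metis coprime_commute diff_is_0_eq dvd_imp_le less_imp_diff_less
          linorder_not_le prime_imp_coprime zero_less_diff)
    ultimately show False using coprime_add_pow_mem[OF I w(1) _ pw] w by blast
  qed
  let ?f = "\<lambda>(a, i). a \<oplus> [i] \<cdot> w"
  have "inj_on ?f ((A \<inter> M) \<times> {..<p})"
  proof (rule inj_onI, clarify)
    fix a b i j
    assume h: "a \<in> A" "a \<in> M" "b \<in> A" "b \<in> M" "i < p" "j < p"
      and eq: "a \<oplus> [i] \<cdot> w = b \<oplus> [j] \<cdot> w"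
    have "i = j" using le[of i j a b] le[of j i b a] h eq
      by (metis IntI linorder_neqE_nat)
    moreover have "a \<in> carrier R" "b \<in> carrier R" using h A by auto
    ultimately show "a = b \<and> i = j" using eq w by simp
  qed
  moreover have "?f ` ((A \<inter> M) \<times> {..<p}) \<subseteq> A" using mult by auto
  moreover have "finite A" using A fin finite_subset by blast
  ultimately have "card ((A \<inter> M) \<times> {..<p}) \<le> card A"
    by (metis card_inj_on_le)
  then show ?thesis by (simp add: card_cartesian_product mult.commute)
qed

lemma prime_power_mem:
  assumes "primeideal M R" "x \<in> carrier R" "x [^] (k::nat) \<in> M" shows "x \<in> M"
  using assms(3)
proof (induction k)
  case 0
  then show ?case
    using assms(1,2) by (metis ideal.one_imp_carrier nat_pow_0 primeideal.axioms(1))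
next
  case (Suc k)
  then show ?case using primeideal.I_prime[OF assms(1), of "x [^] k" x] assms(2) by auto
qed

lemma add_pow_mult_one:
  "[(i * j :: nat)] \<cdot> \<one> = ([i] \<cdot> \<one>) \<otimes> ([j] \<cdot> \<one>)"
  by (simp add: add_pow_ldistr add.nat_pow_pow mult.commute)

lemma add_pow_power_one:
  "[(i ^ k :: nat)] \<cdot> \<one> = ([i] \<cdot> \<one>) [^] k"
proof (induction k)
  case (Suc k)
  have "[(i ^ Suc k)] \<cdot> \<one> = ([(i ^ k)] \<cdot> \<one>) \<otimes> ([i] \<cdot> \<one>)"
    by (simp only: add_pow_mult_one[symmetric] power_Suc mult.commute)
  then show ?case using Suc by simp
qed simp

lemma set_add_memI: "x \<in> I \<Longrightarrow> y \<in> J \<Longrightarrow> x \<oplus> y \<in> I <+> J"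
  by (auto simp: set_add_def')

text \<open>A product of elements of the individual \<open>N\<close>, each chosen outside
  \<open>M\<close>, lies in all of them and stays outside \<open>M\<close> because \<open>M\<close>
  is prime.\<close>

lemma maximalideals_not_subset:
  assumes "finite F" "\<And>N. N \<in> F \<Longrightarrow> maximalideal N R" "maximalideal M R" "M \<notin> F"
  shows "\<exists>w\<in>carrier R. (\<forall>N\<in>F. w \<in> N) \<and> w \<notin> M"
  using assms(1,2,4)
proof (induction F rule: finite_induct)
  case empty
  have "M \<noteq> carrier R" "M \<subseteq> carrier R"
    using maximalideal.I_notcarr[OF assms(3)] ideal.Icarr[OF maximalideal.axioms(1)[OF assms(3)]]
    by auto
  then show ?case by auto
next
  case (insert N F)
  have N: "maximalideal N R" "ideal N R" using insert.prems by (auto simp: maximalideal.axioms(1))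
  have M: "ideal M R" "primeideal M R"
    using assms(3) maximalideal_prime by (auto simp: maximalideal.axioms(1))
  obtain w where w: "w \<in> carrier R" "\<forall>N\<in>F. w \<in> N" "w \<notin> M"
    using insert by (metis insertCI)
  have "\<not> N \<subseteq> M"
    using maximalideal.I_maximal[OF N(1) M(1)] insert.prems ideal.Icarr[OF M(1)]
      maximalideal.I_notcarr[OF assms(3)] by blast
  then obtain z where z: "z \<in> N" "z \<notin> M" by blast
  have zc: "z \<in> carrier R" using ideal.Icarr[OF N(2) z(1)] .
  have "w \<otimes> z \<notin> M" using primeideal.I_prime[OF M(2) w(1) zc] w z by blast
  moreover have "w \<otimes> z \<in> N" using ideal.I_l_closed[OF N(2) z(1) w(1)] .
  moreover have "w \<otimes> z \<in> K" if "K \<in> F" for K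
  proof -
    have "ideal K R" using insert.prems(1)[of K] that by (simp add: maximalideal.axioms(1))
    then show ?thesis using ideal.I_r_closed[of K R w z] w zc that by simp
  qed
  ultimately show ?case using w zc by (intro bexI[of _ "w \<otimes> z"]) auto
qed

text \<open>Induction on \<open>F\<close>. The elements avoiding all of \<open>F\<close> and those
  common to all of \<open>F\<close> are both stable under adding some \<open>w\<close> that lies in
  every member of \<open>F\<close> but not in the new ideal \<open>M\<close>; hence \<open>M\<close>
  contains at most one in \<open>p\<close> of either. The first bound will produce units, the second
  limits how many maximal ideals can contain \<open>p\<close>.\<close>

lemma card_avoiding_maximalideals:
  assumes fin: "finite (carrier R)" and p: "Factorial_Ring.prime (p::nat)"
    and "finite F" "\<And>N. N \<in> F \<Longrightarrow> maximalideal N R \<and> [p] \<cdot> \<one> \<in> N"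
  shows "real (card (carrier R)) * (1 - 1 / real p) ^ card F
           \<le> real (card {a \<in> carrier R. \<forall>N\<in>F. a \<notin> N}) \<and>
         card {a \<in> carrier R. \<forall>N\<in>F. a \<in> N} * p ^ card F \<le> card (carrier R)"
  using assms(3,4)
proof (induction F rule: finite_induct)
  case (insert M F)
  have M: "maximalideal M R" "primeideal M R" "ideal M R" "[p] \<cdot> \<one> \<in> M"
    using insert.prems[of M] by (auto simp: maximalideal_prime maximalideal.axioms(1))
  obtain w where w: "w \<in> carrier R" "\<forall>N\<in>F. w \<in> N" "w \<notin> M"
    using maximalideals_not_subset[of F M] insert M by auto
  define A where "A = {a \<in> carrier R. \<forall>N\<in>F. a \<notin> N}"
  define I where "I = {a \<in> carrier R. \<forall>N\<in>F. a \<in> N}"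
  have p0: "p > 0" using p prime_gt_0_nat by blast
  have fA: "finite A" using fin by (auto simp: A_def)
  have idF: "ideal N R" if "N \<in> F" for N
    using insert.prems that by (auto simp: maximalideal.axioms(1))
  have "p * card (A \<inter> M) \<le> card A"
  proof (rule card_inter_prime_le[OF fin M(2) p M(4) _ w(1,3)])
    show "A \<subseteq> carrier R" by (auto simp: A_def)
    fix a assume a: "a \<in> A"
    have "a \<oplus> w \<notin> N" if "N \<in> F" for N
    proof
      assume "a \<oplus> w \<in> N"
      then have "(a \<oplus> w) \<ominus> w \<in> N" using ideal_minus_closed[OF idF] w that by blast
      moreover have "(a \<oplus> w) \<ominus> w = a"
        using a w(1) unfolding A_def by (simp add: a_minus_def a_assoc r_neg)
      ultimately show False using a that by (auto simp: A_def)
    qed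
    then show "a \<oplus> w \<in> A" using a w by (auto simp: A_def)
  qed
  then have "real p * real (card (A \<inter> M)) \<le> real (card A)"
    by (metis of_nat_le_iff of_nat_mult)
  moreover have "card (A - M) + card (A \<inter> M) = card A"
    using fA by (metis add.commute card_Diff_subset_Int card_mono finite_Int inf_le1
        le_add_diff_inverse)
  then have eq: "real (card (A - M)) = real (card A) - real (card (A \<inter> M))" by linarith
  ultimately have "real (card A) * (1 - 1 / real p) \<le> real (card (A - M))"
    unfolding eq using p0 by (simp add: field_simps)
  moreover have "{a \<in> carrier R. \<forall>N\<in>insert M F. a \<notin> N} = A - M" by (auto simp: A_def)
  moreover have "real (card (carrier R)) * (1 - 1 / real p) ^ card F \<le> real (card A)"
    using insert by (auto simp: A_def)
  then have "real (card (carrier R)) * (1 - 1 / real p) ^ card F * (1 - 1 / real p)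
      \<le> real (card A) * (1 - 1 / real p)"
    using p0 by (intro mult_right_mono) (auto simp: field_simps)
  ultimately have 1: "real (card (carrier R)) * (1 - 1 / real p) ^ card (insert M F)
           \<le> real (card {a \<in> carrier R. \<forall>N\<in>insert M F. a \<notin> N})"
    using insert.hyps by (simp add: mult_ac)
  have "p * card (I \<inter> M) \<le> card I"
  proof (rule card_inter_prime_le[OF fin M(2) p M(4) _ w(1,3)])
    show "I \<subseteq> carrier R" by (auto simp: I_def)
    fix a assume "a \<in> I"
    then show "a \<oplus> w \<in> I"
      using w idF by (auto simp: I_def additive_subgroup.a_closed ideal.axioms(1))
  qed
  then have "p * card (I \<inter> M) * p ^ card F \<le> card I * p ^ card F" by (rule mult_right_mono) simp
  also have "\<dots> \<le> card (carrier R)" using insert by (auto simp: I_def)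
  finally have 2: "card (I \<inter> M) * p ^ card (insert M F) \<le> card (carrier R)"
    using insert.hyps by (simp add: mult_ac)
  have "{a \<in> carrier R. \<forall>N\<in>insert M F. a \<in> N} = I \<inter> M" by (auto simp: I_def)
  then show ?case using 1 2 by simp
qed simp

text \<open>At most \<open>d\<close> maximal ideals contain \<open>p\<close>, because their
  intersection contains the ideal of \<open>p\<close>, whose index is at most \<open>p ^ d\<close>.
  An element outside all of them generates, together with \<open>p ^ v\<close>, an ideal inside no
  maximal ideal, hence the unit ideal.\<close>

lemma card_units_mod_prime_power:
  assumes fin: "finite (carrier R)" and p: "Factorial_Ring.prime (p::nat)"
    and dim: "card (carrier R) \<le> card (PIdl ([p] \<cdot> \<one>)) * p ^ d"
  shows "real (card (carrier R)) * (1 - 1 / real p) ^ d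
    \<le> real (card {a \<in> carrier R. \<exists>b\<in>carrier R. a \<otimes> b \<ominus> \<one> \<in> PIdl ([(p ^ v)] \<cdot> \<one>)})"
proof -
  define F where "F = {N. maximalideal N R \<and> [p] \<cdot> \<one> \<in> N}"
  have "F \<subseteq> Pow (carrier R)"
    unfolding F_def by (auto dest: maximalideal.axioms(1) ideal.Icarr)
  then have fF: "finite F" using fin by (meson finite_Pow_iff finite_subset)
  have p1: "p > 1" using p prime_gt_1_nat by blast
  have *: "real (card (carrier R)) * (1 - 1 / real p) ^ card F
           \<le> real (card {a \<in> carrier R. \<forall>N\<in>F. a \<notin> N})"
    "card {a \<in> carrier R. \<forall>N\<in>F. a \<in> N} * p ^ card F \<le> card (carrier R)"
    using card_avoiding_maximalideals[OF fin p fF] by (auto simp: F_def)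
  have "PIdl ([p] \<cdot> \<one>) \<subseteq> {a \<in> carrier R. \<forall>N\<in>F. a \<in> N}"
    unfolding F_def by (auto simp: cgenideal_def intro: ideal.I_l_closed dest: maximalideal.axioms(1))
  then have "card (PIdl ([p] \<cdot> \<one>)) \<le> card {a \<in> carrier R. \<forall>N\<in>F. a \<in> N}"
    using fin by (intro card_mono) auto
  then have "card (PIdl ([p] \<cdot> \<one>)) * p ^ card F
      \<le> card {a \<in> carrier R. \<forall>N\<in>F. a \<in> N} * p ^ card F"
    by (rule mult_right_mono) simp
  then have "card (PIdl ([p] \<cdot> \<one>)) * p ^ card F \<le> card (PIdl ([p] \<cdot> \<one>)) * p ^ d"
    using *(2) dim by linarith
  moreover have "card (carrier R) > 0" using fin one_closed card_gt_0_iff by blast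
  then have "card (PIdl ([p] \<cdot> \<one>)) > 0" using dim by (intro gr0I) simp
  ultimately have "p ^ card F \<le> p ^ d" by simp
  then have "card F \<le> d" using p1 power_increasing_iff by blast
  then have "(1 - 1 / real p) ^ d \<le> (1 - 1 / real p) ^ card F"
    using p1 by (intro power_decreasing) (auto simp: field_simps)
  then have "real (card (carrier R)) * (1 - 1 / real p) ^ d
      \<le> real (card (carrier R)) * (1 - 1 / real p) ^ card F"
    by (intro mult_left_mono) auto
  also have "\<dots> \<le> real (card {a \<in> carrier R. \<forall>N\<in>F. a \<notin> N})"
    by (rule *(1))
  finally have bound: "real (card (carrier R)) * (1 - 1 / real p) ^ d
      \<le> real (card {a \<in> carrier R. \<forall>N\<in>F. a \<notin> N})" .
  have "{a \<in> carrier R. \<forall>N\<in>F. a \<notin> N}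
      \<subseteq> {a \<in> carrier R. \<exists>b\<in>carrier R. a \<otimes> b \<ominus> \<one> \<in> PIdl ([(p ^ v)] \<cdot> \<one>)}"
  proof clarify
    fix a assume a: "a \<in> carrier R" and avoid: "\<forall>N\<in>F. a \<notin> N"
    let ?Q = "PIdl ([(p ^ v)] \<cdot> \<one>)"
    have Q: "ideal ?Q R" by (intro cgenideal_ideal) simp
    have J: "ideal (PIdl a <+>\<^bsub>R\<^esub> ?Q) R" using add_ideals[OF cgenideal_ideal[OF a] Q] .
    have sub: "a \<in> PIdl a <+>\<^bsub>R\<^esub> ?Q" "[(p ^ v)] \<cdot> \<one> \<in> PIdl a <+>\<^bsub>R\<^esub> ?Q"
    proof -
      have z: "\<zero> \<in> PIdl a" "\<zero> \<in> ?Q"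
        using Q cgenideal_ideal[OF a] by (simp_all add: additive_subgroup.zero_closed ideal.axioms(1))
      have s: "a \<in> PIdl a" "[(p ^ v)] \<cdot> \<one> \<in> ?Q"
        using a by (auto intro: cgenideal_self)
      have "a \<oplus> \<zero> \<in> PIdl a <+>\<^bsub>R\<^esub> ?Q" "\<zero> \<oplus> [(p ^ v)] \<cdot> \<one> \<in> PIdl a <+>\<^bsub>R\<^esub> ?Q"
        using z s by (blast intro: set_add_memI)+
      then show "a \<in> PIdl a <+>\<^bsub>R\<^esub> ?Q" "[(p ^ v)] \<cdot> \<one> \<in> PIdl a <+>\<^bsub>R\<^esub> ?Q" using a by simp_all
    qed
    have "\<one> \<in> PIdl a <+>\<^bsub>R\<^esub> ?Q"
    proof (rule ccontr)
      assume "\<one> \<notin> PIdl a <+>\<^bsub>R\<^esub> ?Q"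
      then obtain M where M: "maximalideal M R" "PIdl a <+>\<^bsub>R\<^esub> ?Q \<subseteq> M"
        using maximalideal_containing[OF fin J] by blast
      have "([p] \<cdot> \<one>) [^] v \<in> M" using M sub add_pow_power_one[of p v] by auto
      then have "[p] \<cdot> \<one> \<in> M"
        using prime_power_mem maximalideal_prime[OF M(1)] by auto
      then show False using avoid M sub by (auto simp: F_def)
    qed
    then obtain b z where b: "b \<in> carrier R" "z \<in> ?Q" "\<one> = b \<otimes> a \<oplus> z"
      by (auto simp: set_add_def' cgenideal_def[of R a])
    have zc: "z \<in> carrier R" using ideal.Icarr[OF Q b(2)] .
    have "a \<otimes> b \<ominus> (b \<otimes> a \<oplus> z) = \<ominus> z" using a b(1) zc by algebra
    then have "a \<otimes> b \<ominus> \<one> \<in> ?Q"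
      using b Q by (simp add: additive_subgroup.a_inv_closed ideal.axioms(1))
    then show "\<exists>b\<in>carrier R. a \<otimes> b \<ominus> \<one> \<in> ?Q" using b by blast
  qed
  then have "real (card {a \<in> carrier R. \<forall>N\<in>F. a \<notin> N})
      \<le> real (card {a \<in> carrier R. \<exists>b\<in>carrier R. a \<otimes> b \<ominus> \<one> \<in> PIdl ([(p ^ v)] \<cdot> \<one>)})"
    using fin by (intro of_nat_mono card_mono) auto
  with bound show ?thesis by linarith
qed

end

section \<open>Additive power maps of finite domains\<close>

lemma (in UP_cring) coeff_mult_X:
  assumes f: "f \<in> carrier P"
  shows "up_ring.coeff P (f \<otimes>\<^bsub>P\<^esub> up_ring.monom P \<one> 1) n = (if n = 0 then \<zero> else up_ring.coeff P f (n - 1))"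
proof (cases n)
  case 0
  then show ?thesis using f by (simp add: coeff_mult)
next
  case (Suc m)
  have "up_ring.coeff P (f \<otimes>\<^bsub>P\<^esub> up_ring.monom P \<one> 1) n
      = (\<Oplus>i\<in>{..n}. up_ring.coeff P f i \<otimes> (if 1 = n - i then \<one> else \<zero>))"
    using f by (simp add: coeff_mult)
  also have "\<dots> = (\<Oplus>i\<in>{..n}. if m = i then up_ring.coeff P f i else \<zero>)"
    using f Suc by (intro R.finsum_cong') (auto simp: Pi_def)
  also have "\<dots> = up_ring.coeff P f m"
    using f Suc by (subst R.finsum_singleton[of m "{..n}"]) auto
  finally show ?thesis using Suc by simp
qed

lemma (in UP_cring) coeff_binomial:
  "up_ring.coeff P ((up_ring.monom P \<one> 1 \<oplus>\<^bsub>P\<^esub> \<one>\<^bsub>P\<^esub>) [^]\<^bsub>P\<^esub> s) i = [(s choose i)] \<cdot> \<one>"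
proof (induction s arbitrary: i)
  case 0
  then show ?case by (cases i) auto
next
  case (Suc s)
  let ?b = "up_ring.monom P \<one> 1 \<oplus>\<^bsub>P\<^esub> \<one>\<^bsub>P\<^esub>"
  have c: "?b [^]\<^bsub>P\<^esub> s \<in> carrier P" "up_ring.monom P \<one> 1 \<in> carrier P" by auto
  have "?b [^]\<^bsub>P\<^esub> Suc s = ?b [^]\<^bsub>P\<^esub> s \<otimes>\<^bsub>P\<^esub> up_ring.monom P \<one> 1 \<oplus>\<^bsub>P\<^esub> ?b [^]\<^bsub>P\<^esub> s"
    using c by (simp add: P.r_distr)
  then have "up_ring.coeff P (?b [^]\<^bsub>P\<^esub> Suc s) i =
      up_ring.coeff P (?b [^]\<^bsub>P\<^esub> s \<otimes>\<^bsub>P\<^esub> up_ring.monom P \<one> 1) i \<oplus> up_ring.coeff P (?b [^]\<^bsub>P\<^esub> s) i"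
    using c by (simp del: P.nat_pow_Suc)
  also have "\<dots> = [(Suc s choose i)] \<cdot> \<one>"
    unfolding coeff_mult_X[OF c(1)] Suc by (cases i) (simp_all add: R.add.nat_pow_mult)
  finally show ?case .
qed

text \<open>The polynomial \<open>(X + 1) ^ s - X ^ s - 1\<close> vanishes on the whole ring, which
  has more than \<open>s\<close> elements, while its degree is at most \<open>s\<close>. So it is
  zero, and the inner binomial coefficients of \<open>s\<close> vanish in the ring. If
  \<open>s = p ^ a * m\<close> with \<open>m > 1\<close> prime to \<open>p\<close>, the coefficient
  at \<open>p ^ a\<close> would be prime to \<open>p\<close>.\<close>

lemma (in domain) additive_power_map:
  fixes s p :: nat
  assumes fin: "finite (carrier R)" and p: "Factorial_Ring.prime p" and char: "[p] \<cdot> \<one> = \<zero>"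
    and s: "0 < s" "s < card (carrier R)"
    and add: "\<And>t. t \<in> carrier R \<Longrightarrow> (t \<oplus> \<one>) [^] s = t [^] s \<oplus> \<one>"
  shows "\<exists>a. s = p ^ a"
proof -
  interpret U: UP_domain R "UP R" by unfold_locales
  let ?P = "UP R"
  define b where "b = up_ring.monom ?P \<one> 1 \<oplus>\<^bsub>?P\<^esub> \<one>\<^bsub>?P\<^esub>"
  define E where "E = UnivPoly.eval R R id"
  note evs = U.evalRR_simps[folded E_def]
  let ?h = "up_ring.monom ?P \<one> s \<oplus>\<^bsub>?P\<^esub> \<one>\<^bsub>?P\<^esub>"
  let ?f = "b [^]\<^bsub>?P\<^esub> s \<ominus>\<^bsub>?P\<^esub> ?h"
  have c: "b \<in> carrier ?P" "b [^]\<^bsub>?P\<^esub> k \<in> carrier ?P" "?h \<in> carrier ?P" for k :: nat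
    by (auto simp: b_def)
  have coeff_b: "up_ring.coeff ?P (b [^]\<^bsub>?P\<^esub> s) i = [(s choose i)] \<cdot> \<one>" for i
    unfolding b_def by (rule U.coeff_binomial)
  have root: "E t ?f = \<zero>" if t: "t \<in> carrier R" for t
  proof -
    have ev: "E t b = t \<oplus> \<one>"
      using t unfolding b_def by (simp add: evs)
    have "E t (b [^]\<^bsub>?P\<^esub> k) = (t \<oplus> \<one>) [^] k" for k :: nat
    proof (induction k)
      case (Suc k)
      then show ?case using t c ev by (simp add: evs)
    qed (use t in \<open>simp add: evs\<close>)
    moreover have "E t ?h = t [^] s \<oplus> \<one>" using t by (simp add: evs)
    ultimately show ?thesis using t c add[OF t] by (simp add: evs(2))
  qed
  have "?f = \<zero>\<^bsub>?P\<^esub>"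
  proof (rule ccontr)
    assume "?f \<noteq> \<zero>\<^bsub>?P\<^esub>"
    then have "card {a \<in> carrier R. E a ?f = \<zero>} \<le> deg R ?f"
      using U.roots_bound[of ?f, folded E_def] c fin by auto
    moreover have "{a \<in> carrier R. E a ?f = \<zero>} = carrier R" using root by auto
    moreover have "deg R ?f \<le> s"
      using c by (intro U.deg_aboveI) (auto simp: coeff_b a_minus_def binomial_eq_0)
    ultimately show False using s by simp
  qed
  then have co: "[(s choose i)] \<cdot> \<one> = \<zero>" if "0 < i" "i < s" for i
  proof -
    have "up_ring.coeff ?P ?f i = [(s choose i)] \<cdot> \<one>"
      using that c by (simp add: coeff_b a_minus_def)
    then show ?thesis using \<open>?f = \<zero>\<^bsub>?P\<^esub>\<close> by simp
  qed
  define a where "a = multiplicity p s"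
  obtain m where m: "s = p ^ a * m" "\<not> p dvd m"
    using s p unfolding a_def by (metis multiplicity_decompose' not_prime_unit not_gr_zero)
  have "m = 1"
  proof (rule ccontr)
    assume "m \<noteq> 1"
    have m0: "m > 0" using m s by (cases m) auto
    \<comment> \<open>\<open>const_p_fac\<close>, familiar from the proof of Sylow's theorem,
      equates the multiplicity of \<open>p\<close> in this coefficient with that in
      \<open>m\<close>.\<close>
    have "multiplicity p (s choose p ^ a) = 0"
      using const_p_fac[OF m0 p, of a] m by (simp add: not_dvd_imp_multiplicity_0)
    moreover have "s choose p ^ a \<noteq> 0" using m m0 by simp
    ultimately have "coprime (s choose p ^ a) p"
      using p by (metis coprime_commute multiplicity_eq_zero_iff not_prime_unit prime_imp_coprime)
    moreover have "[(s choose p ^ a)] \<cdot> \<one> = \<zero>"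
      using co[of "p ^ a"] m m0 \<open>m \<noteq> 1\<close> p by (auto simp: prime_gt_0_nat)
    ultimately have "\<one> \<in> {\<zero>}"
      using char by (intro coprime_add_pow_mem[OF zeroideal, of \<one> _ p]) auto
    then show False by simp
  qed
  then show ?thesis using m by auto
qed

section \<open>Solutions modulo a prime power\<close>

text \<open>The consequences of a cyclic extension on which the counting rests, stated in the ring
  alone with scalars as integer multiples of \<open>\<one>\<close>. \<open>fixed\<close> and
  \<open>char\<close> say that the elements fixed by \<open>\<sigma>\<close> form a copy of
  \<open>\<int>/n\<close>; \<open>card_ideal\<close> records freeness of rank \<open>d\<close> as
  the index of the ideal of \<open>m\<close>.\<close>

locale cyclic_algebra_mod = cring R for R (structure) +
  fixes \<sigma> :: "'a \<Rightarrow> 'a" and n d p v :: nat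
  assumes fin: "finite (carrier R)"
    and \<sigma>_hom: "\<sigma> \<in> ring_hom R R"
    and \<sigma>_bij: "bij_betw \<sigma> (carrier R) (carrier R)"
    and fixed: "\<And>x. x \<in> carrier R \<Longrightarrow> \<sigma> x = x \<Longrightarrow> \<exists>r::nat. x = [r] \<cdot> \<one>"
    and char: "\<And>r::nat. [r] \<cdot> \<one> = \<zero> \<longleftrightarrow> n dvd r"
    and card_ideal: "\<And>m::nat. m dvd n \<Longrightarrow> card (PIdl ([m] \<cdot> \<one>)) * m ^ d = card (carrier R)"
    and n3: "n \<ge> 3" and not_primepow: "\<not> primepow n"
    and p: "Factorial_Ring.prime p" and v: "v \<ge> 1" and q_dvd: "p ^ v dvd n"
begin

abbreviation Q where "Q \<equiv> PIdl ([(p ^ v)] \<cdot> \<one>)"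

sublocale hom: ring_hom_cring R R \<sigma>
  by unfold_locales (rule \<sigma>_hom)

lemma Q_ideal: "ideal Q R"
  by (intro cgenideal_ideal) simp

lemma p_dvd: "p dvd n"
  using dvd_trans[OF dvd_power q_dvd] v by simp

lemma hom_add_pow: "x \<in> carrier R \<Longrightarrow> \<sigma> ([(k::nat)] \<cdot> x) = [k] \<cdot> \<sigma> x"
  by (induction k) auto

lemma hom_minus: "x \<in> carrier R \<Longrightarrow> y \<in> carrier R \<Longrightarrow> \<sigma> (x \<ominus> y) = \<sigma> x \<ominus> \<sigma> y"
  by (simp add: a_minus_def)

lemma \<sigma>_inj: "x \<in> carrier R \<Longrightarrow> y \<in> carrier R \<Longrightarrow> \<sigma> x = \<sigma> y \<Longrightarrow> x = y"
  using \<sigma>_bij by (metis bij_betw_imp_inj_on inj_onD)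

lemma Q_stable:
  assumes "z \<in> Q" shows "\<sigma> z \<in> Q"
proof -
  obtain x where x: "x \<in> carrier R" "z = x \<otimes> [(p ^ v)] \<cdot> \<one>"
    using assms by (auto simp: cgenideal_def)
  then have "\<sigma> z = \<sigma> x \<otimes> [(p ^ v)] \<cdot> \<one>" by (simp add: hom_add_pow)
  then show ?thesis using x hom.hom_closed unfolding cgenideal_def by blast
qed

lemma add_pow_mem_Q:
  assumes "p ^ v dvd k" shows "[k] \<cdot> \<one> \<in> Q"
proof -
  obtain c where "k = c * p ^ v" using assms by (metis dvdE mult.commute)
  then show ?thesis unfolding cgenideal_def by (auto simp: add_pow_mult_one)
qed

lemma add_pow_mem:
  assumes "ideal J R" "[p] \<cdot> \<one> \<in> J" "p dvd k" shows "[k] \<cdot> \<one> \<in> J"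
proof -
  obtain c where "k = p * c" using assms(3) by blast
  then show ?thesis
    using ideal.I_r_closed[OF assms(1,2), of "[c] \<cdot> \<one>"] by (simp add: add_pow_mult_one)
qed

lemma Q_subset:
  assumes J: "ideal J R" "[p] \<cdot> \<one> \<in> J" shows "Q \<subseteq> J"
proof -
  have "[(p ^ v)] \<cdot> \<one> \<in> J" using v by (intro add_pow_mem[OF J]) auto
  then show ?thesis using ideal.I_l_closed[OF J(1)] by (auto simp: cgenideal_def)
qed

lemma one_minus_finprod_mem:
  assumes J: "ideal J R" and "finite E" "E \<subseteq> J"
  shows "\<one> \<ominus> (\<Otimes>z\<in>E. \<one> \<ominus> z) \<in> J"
  using assms(2,3)
proof (induction E rule: finite_induct)
  case empty
  show ?case using additive_subgroup.zero_closed[OF ideal.axioms(1)[OF J]] by (simp add: r_neg a_minus_def)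
next
  case (insert z E)
  have z: "z \<in> J" "z \<in> carrier R" and E: "E \<subseteq> carrier R"
    using insert.prems ideal.Icarr[OF J] by auto
  define W where "W = (\<Otimes>z\<in>E. \<one> \<ominus> z)"
  have W: "W \<in> carrier R" using E by (auto simp: W_def Pi_def intro!: finprod_closed)
  have "(\<Otimes>z\<in>insert z E. \<one> \<ominus> z) = (\<one> \<ominus> z) \<otimes> W"
    unfolding W_def using insert.hyps E z by (intro finprod_insert) auto
  moreover have "\<one> \<ominus> (\<one> \<ominus> z) \<otimes> W = (\<one> \<ominus> W) \<oplus> z \<otimes> W" using z W by algebra
  moreover have "\<one> \<ominus> W \<in> J" using insert by (simp add: W_def)
  moreover have "z \<otimes> W \<in> J" using ideal.I_r_closed[OF J z(1) W] .
  ultimately show ?case using additive_subgroup.a_closed[OF ideal.axioms(1)[OF J]] by metis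
qed

text \<open>The product of \<open>1 - e\<close> over all idempotents \<open>e\<close> of \<open>J\<close> is an idempotent fixed by \<open>\<sigma>\<close>, hence
  an idempotent of \<open>\<int>/n\<close>; as it is not in \<open>J\<close>, it is \<open>1\<close> modulo \<open>p ^ v\<close>.\<close>

lemma stable_ideal_nil:
  assumes J: "ideal J R" and one: "\<one> \<notin> J" and pJ: "[p] \<cdot> \<one> \<in> J"
    and stable: "\<And>z. z \<in> J \<Longrightarrow> \<sigma> z \<in> J" and y: "y \<in> J"
  shows "\<exists>k::nat. y [^] k \<in> Q"
proof -
  have yc: "y \<in> carrier R" using ideal.Icarr[OF J y] .
  obtain k :: nat where k: "k > 0" and idem: "y [^] k \<otimes> y [^] k = y [^] k"
    using finite_idempotent_power[OF fin yc] by auto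
  define E where "E = {z \<in> J. z \<otimes> z = z}"
  have Ec: "E \<subseteq> carrier R" using ideal.Icarr[OF J] by (auto simp: E_def)
  have fE: "finite E" using Ec fin finite_subset by blast
  have "\<sigma> ` E \<subseteq> E"
    using stable Ec by (auto simp: E_def hom.hom_mult[symmetric] simp del: hom.hom_mult)
  moreover have injE: "inj_on \<sigma> E" using \<sigma>_bij Ec by (auto simp: bij_betw_def intro: inj_on_subset)
  ultimately have imE: "\<sigma> ` E = E" using endo_inj_surj[OF fE] by blast
  define w where "w = (\<Otimes>z\<in>E. \<one> \<ominus> z)"
  have fc: "(\<lambda>z. \<one> \<ominus> z) \<in> E \<rightarrow> carrier R" using Ec by auto
  have wc: "w \<in> carrier R" unfolding w_def using fc by (rule finprod_closed)
  have "\<sigma> w = (\<Otimes>z\<in>E. \<sigma> (\<one> \<ominus> z))"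
    unfolding w_def using hom.hom_finprod[OF fc] by (simp add: o_def)
  also have "\<dots> = (\<Otimes>z\<in>E. \<one> \<ominus> \<sigma> z)"
    using Ec by (intro finprod_cong') (auto simp: hom_minus)
  also have "\<dots> = (\<Otimes>z\<in>\<sigma> ` E. \<one> \<ominus> z)"
    using Ec injE imE by (intro finprod_reindex[symmetric]) auto
  also have "\<dots> = w" unfolding imE w_def ..
  finally obtain r :: nat where r: "w = [r] \<cdot> \<one>" using fixed[OF wc] by blast
  have "w \<otimes> w = (\<Otimes>z\<in>E. (\<one> \<ominus> z) \<otimes> (\<one> \<ominus> z))"
    unfolding w_def using fc by (intro finprod_multf[symmetric])
  also have "\<dots> = w" unfolding w_def
  proof (rule finprod_cong')
    fix z assume z: "z \<in> E"
    then have zc: "z \<in> carrier R" and zz: "z \<otimes> z = z" using Ec by (auto simp: E_def)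
    have "(\<one> \<ominus> z) \<otimes> (\<one> \<ominus> z) = \<one> \<ominus> z \<ominus> z \<oplus> z \<otimes> z" using zc by algebra
    also have "\<dots> = \<one> \<ominus> z" unfolding zz using zc by algebra
    finally show "(\<one> \<ominus> z) \<otimes> (\<one> \<ominus> z) = \<one> \<ominus> z" .
  qed (use fc in auto)
  finally have ww: "w \<otimes> w = w" .
  have wJ: "\<one> \<ominus> w \<in> J"
    unfolding w_def using fE by (intro one_minus_finprod_mem[OF J]) (auto simp: E_def)
  have "w \<notin> J"
  proof
    assume "w \<in> J"
    then have "(\<one> \<ominus> w) \<oplus> w \<in> J" using wJ additive_subgroup.a_closed[OF ideal.axioms(1)[OF J]] by blast
    moreover have "(\<one> \<ominus> w) \<oplus> w = \<one>" using wc by algebra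
    ultimately show False using one by simp
  qed
  then have pr: "\<not> p dvd r" using add_pow_mem[OF J pJ] r by blast
  then have "r > 0" by (cases r) auto
  \<comment> \<open>As \<open>r\<close> is idempotent modulo \<open>n\<close>, \<open>p ^ v\<close>
    divides \<open>r * (r - 1)\<close>; \<open>r > 0\<close> makes the truncated subtraction
    harmless.\<close>
  then have rr: "r * r = r + r * (r - 1)" by (cases r) auto
  have "[(r * r)] \<cdot> \<one> = [r] \<cdot> \<one>" using ww r by (simp add: add_pow_mult_one)
  then have "[r] \<cdot> \<one> \<oplus> [(r * (r - 1))] \<cdot> \<one> = [r] \<cdot> \<one> \<oplus> \<zero>"
    unfolding rr by (simp add: add.nat_pow_mult)
  then have "[(r * (r - 1))] \<cdot> \<one> = \<zero>" by simp
  then have "p ^ v dvd r * (r - 1)" using char q_dvd dvd_trans by blast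
  moreover have "coprime (p ^ v) r" using p pr by (simp add: prime_imp_coprime)
  ultimately have "p ^ v dvd r - 1" by (simp add: coprime_dvd_mult_right_iff)
  then have "[(r - 1)] \<cdot> \<one> \<in> Q" by (rule add_pow_mem_Q)
  moreover have "w = [(r - 1)] \<cdot> \<one> \<oplus> \<one>"
    unfolding r using \<open>r > 0\<close> by (cases r) auto
  then have "w \<ominus> \<one> = [(r - 1)] \<cdot> \<one>" by (simp add: a_minus_def a_assoc r_neg)
  ultimately have wQ: "w \<ominus> \<one> \<in> Q" by simp
  \<comment> \<open>The idempotent power of \<open>y\<close> is one of the elements of
    \<open>E\<close>, so the factor \<open>\<one> \<ominus> e\<close> of \<open>w\<close> gives
    \<open>e \<otimes> w = \<zero>\<close>; as \<open>w\<close> is \<open>\<one>\<close> modulo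
    \<open>Q\<close>, \<open>e\<close> lies in \<open>Q\<close>.\<close>
  define e where "e = y [^] k"
  have "e \<in> J"
  proof -
    have "y [^] (k - 1) \<otimes> y \<in> J" using ideal.I_l_closed[OF J y] yc by simp
    then show ?thesis using k unfolding e_def by (metis Suc_diff_1 nat_pow_Suc)
  qed
  then have eE: "e \<in> E" using idem by (simp add: E_def e_def)
  have ec: "e \<in> carrier R" and ee: "e \<otimes> e = e" using yc idem by (auto simp: e_def)
  define W where "W = (\<Otimes>z\<in>E - {e}. \<one> \<ominus> z)"
  have W: "W \<in> carrier R" unfolding W_def using fc by (intro finprod_closed) auto
  have "w = (\<Otimes>z\<in>insert e (E - {e}). \<one> \<ominus> z)" using eE by (simp add: w_def insert_absorb)
  also have "\<dots> = (\<one> \<ominus> e) \<otimes> W"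
    unfolding W_def using fE fc ec by (intro finprod_insert) auto
  finally have "e \<otimes> w = (e \<ominus> e \<otimes> e) \<otimes> W" using ec W by algebra
  also have "\<dots> = \<zero>" unfolding ee using ec W by algebra
  finally have ew: "e \<otimes> w = \<zero>" .
  have "e = (e \<otimes> w) \<ominus> e \<otimes> (w \<ominus> \<one>)" using ec wc by algebra
  also have "\<dots> = \<ominus> (e \<otimes> (w \<ominus> \<one>))" using ec wc by (simp add: ew a_minus_def)
  also have "\<dots> \<in> Q"
    using ideal.I_l_closed[OF Q_ideal wQ ec] additive_subgroup.a_inv_closed[OF ideal.axioms(1)[OF Q_ideal]]
    by blast
  finally show ?thesis unfolding e_def by blast
qed

text \<open>Take for \<open>s\<close> the geometric sum of the powers of
  \<open>\<one> \<oplus> y\<close> with exponents below \<open>N\<close>; each of its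
  \<open>N\<close> terms is \<open>\<one>\<close> modulo \<open>J\<close>.\<close>

lemma geometric_sum_mod:
  assumes J: "ideal J R" and y: "y \<in> J"
  shows "\<exists>s\<in>carrier R. (\<one> \<oplus> y) [^] (N::nat) = \<one> \<oplus> y \<otimes> s \<and> s \<ominus> [N] \<cdot> \<one> \<in> J"
proof (induction N)
  case 0
  have "y \<in> carrier R" using ideal.Icarr[OF J y] .
  then show ?case
    using additive_subgroup.zero_closed[OF ideal.axioms(1)[OF J]]
    by (intro bexI[of _ \<zero>]) (auto simp: a_minus_def)
next
  case (Suc N)
  have yc: "y \<in> carrier R" using ideal.Icarr[OF J y] .
  obtain s where s: "s \<in> carrier R" "(\<one> \<oplus> y) [^] N = \<one> \<oplus> y \<otimes> s" "s \<ominus> [N] \<cdot> \<one> \<in> J"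
    using Suc by blast
  define c where "c = [N] \<cdot> \<one>"
  have cc: "c \<in> carrier R" by (simp add: c_def)
  have "(\<one> \<oplus> y) [^] Suc N = \<one> \<oplus> y \<otimes> (s \<oplus> \<one> \<oplus> y \<otimes> s)"
    using s(1) yc unfolding nat_pow_Suc s(2) by algebra
  moreover have "(s \<oplus> \<one> \<oplus> y \<otimes> s) \<ominus> (c \<oplus> \<one>) = (s \<ominus> c) \<oplus> y \<otimes> s"
    using s(1) yc cc by algebra
  moreover have "(s \<ominus> c) \<oplus> y \<otimes> s \<in> J"
    using s ideal.I_r_closed[OF J y s(1)] additive_subgroup.a_closed[OF ideal.axioms(1)[OF J]]
    by (simp add: c_def)
  ultimately show ?case using s(1) yc by (intro bexI[of _ "s \<oplus> \<one> \<oplus> y \<otimes> s"]) (auto simp: c_def)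
qed

section \<open>Iterates of \<open>\<sigma>\<close>, and solutions congruent to
  \<open>\<one>\<close>\<close>

lemma funpow_hom: "ring_hom_cring R R (\<sigma> ^^ i)"
proof -
  have "(\<sigma> ^^ i) \<in> ring_hom R R"
  proof (induction i)
    case (Suc i)
    then show ?case using ring_hom_trans[OF Suc \<sigma>_hom] by (simp add: o_def)
  qed (simp add: id_def[symmetric])
  then show ?thesis by unfold_locales
qed

lemma funpow_closed: "x \<in> carrier R \<Longrightarrow> (\<sigma> ^^ i) x \<in> carrier R"
  by (induction i) auto

text \<open>The orbit is eventually periodic by the pigeonhole principle, and injectivity of
  \<open>\<sigma>\<close> cancels the part before the period.\<close>

lemma funpow_period:
  assumes x: "x \<in> carrier R"
  shows "\<exists>D>0. (\<sigma> ^^ D) x = x"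
proof -
  have "range (\<lambda>i. (\<sigma> ^^ i) x) \<subseteq> carrier R" using funpow_closed[OF x] by auto
  then have "\<not> inj (\<lambda>i. (\<sigma> ^^ i) x)"
    using fin finite_subset range_inj_infinite by blast
  then obtain i j where "(\<sigma> ^^ i) x = (\<sigma> ^^ j) x" "i \<noteq> j" by (auto simp: inj_def)
  then obtain i l where l: "l > 0" "(\<sigma> ^^ (i + l)) x = (\<sigma> ^^ i) x"
    by (metis less_imp_add_positive linorder_neqE_nat)
  have "(\<sigma> ^^ l) x = x" using l(2)
  proof (induction i)
    case (Suc i)
    then show ?case
      using \<sigma>_inj[OF funpow_closed[OF x] funpow_closed[OF x], of "i + l" i] by simp
  qed simp
  then show ?thesis using l by blast
qed

text \<open>This intersection of preimages of \<open>M\<close> is the largest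
  \<open>\<sigma>\<close>-stable ideal inside \<open>M\<close>.\<close>

lemma orbit_ideal:
  assumes "ideal M R"
  shows "ideal (\<Inter>i. {z \<in> carrier R. (\<sigma> ^^ i) z \<in> M}) R"
proof (rule i_Intersect)
  fix I assume "I \<in> range (\<lambda>i. {z \<in> carrier R. (\<sigma> ^^ i) z \<in> M})"
  then obtain i where I: "I = {z \<in> carrier R. (\<sigma> ^^ i) z \<in> M}" by auto
  interpret h: ring_hom_cring R R "\<sigma> ^^ i" by (rule funpow_hom)
  have "ring_hom_ring R R (\<sigma> ^^ i)" by (intro ring_hom_ringI2 ring_axioms) auto
  then show "ideal I R" unfolding I using ring_hom_ring.ideal_vimage assms by blast
qed auto

text \<open>\<open>Q\<close> is \<open>\<sigma>\<close>-stable, so \<open>\<sigma>\<close> may be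
  applied to congruences modulo \<open>Q\<close>; each application multiplies the exponent by
  \<open>n\<close>.\<close>

lemma funpow_eigen:
  assumes x: "x \<in> carrier R" and eq: "\<sigma> x \<ominus> x [^] n \<in> Q"
  shows "Q +> (\<sigma> ^^ i) x = Q +> x [^] (n ^ i)"
proof (induction i)
  case 0
  then show ?case using x by simp
next
  case (Suc i)
  interpret h: ring_hom_cring R "R Quot Q" "(+>) Q" by (rule quotient_hom[OF Q_ideal])
  let ?z = "(\<sigma> ^^ i) x"
  have z: "?z \<in> carrier R" using funpow_closed[OF x] .
  have "?z \<ominus> x [^] (n ^ i) \<in> Q"
    by (rule coset_eq_iff[OF Q_ideal, THEN iffD1]) (use Suc x z in auto)
  then have "\<sigma> ?z \<ominus> (\<sigma> x) [^] (n ^ i) \<in> Q"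
    using Q_stable x z by (fastforce simp: hom_minus)
  then have "Q +> \<sigma> ?z = Q +> (\<sigma> x) [^] (n ^ i)"
    by (intro coset_eq_iff[OF Q_ideal, THEN iffD2]) (use x z in auto)
  also have "\<dots> = (Q +> \<sigma> x) [^]\<^bsub>R Quot Q\<^esub> (n ^ i)" using x by simp
  also have "Q +> \<sigma> x = Q +> x [^] n"
    by (rule coset_eq_iff[OF Q_ideal, THEN iffD2]) (use x eq in auto)
  also have "(Q +> x [^] n) [^]\<^bsub>R Quot Q\<^esub> (n ^ i) = Q +> (x [^] n) [^] (n ^ i)"
    using x h.hom_pow[of "x [^] n" "n ^ i"] by simp
  also have "\<dots> = Q +> x [^] (n ^ Suc i)" using x by (simp add: nat_pow_pow)
  finally show ?case by simp
qed

lemma eigen_one_mod: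
  assumes M: "ideal M R" "\<one> \<notin> M" "[p] \<cdot> \<one> \<in> M"
    and x: "x \<in> carrier R" and eq: "\<sigma> x \<ominus> x [^] n \<in> Q" and x1: "x \<ominus> \<one> \<in> M"
  shows "x \<ominus> \<one> \<in> Q"
proof -
  define J where "J = (\<Inter>i. {z \<in> carrier R. (\<sigma> ^^ i) z \<in> M})"
  have J: "ideal J R" unfolding J_def by (rule orbit_ideal[OF M(1)])
  have JM: "J \<subseteq> M" 
  proof
    fix z assume "z \<in> J"
    then have "(\<sigma> ^^ 0) z \<in> M" unfolding J_def by blast
    then show "z \<in> M" by simp
  qed
  have fixedn: "(\<sigma> ^^ i) ([(k::nat)] \<cdot> \<one>) = [k] \<cdot> \<one>" for i k
    by (induction i) (auto simp: hom_add_pow)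
  have pJ: "[p] \<cdot> \<one> \<in> J" using M(3) by (auto simp: J_def fixedn)
  have stable: "\<sigma> z \<in> J" if "z \<in> J" for z
  proof -
    have "z \<in> carrier R" "(\<sigma> ^^ Suc i) z \<in> M" for i using that unfolding J_def by blast+
    then show ?thesis by (auto simp: J_def funpow_swap1)
  qed
  define y where "y = x \<ominus> \<one>"
  have yc: "y \<in> carrier R" using x by (simp add: y_def)
  have xy: "x = \<one> \<oplus> y" unfolding y_def using x by algebra
  interpret hM: ring_hom_cring R "R Quot M" "(+>) M" by (rule quotient_hom[OF M(1)])
  have xM: "M +> x = M +> \<one>"
    by (rule coset_eq_iff[OF M(1), THEN iffD2]) (use x x1 in auto)
  \<comment> \<open>Modulo \<open>M\<close> the iterates of \<open>x\<close> are powers of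
    \<open>x\<close>, hence \<open>\<one>\<close>. So all iterates of \<open>y\<close> lie in
    \<open>M\<close>, which puts \<open>y\<close> into \<open>J\<close>.\<close>
  have "(\<sigma> ^^ i) y \<in> M" for i
  proof -
    interpret h: ring_hom_cring R R "\<sigma> ^^ i" by (rule funpow_hom)
    have "(\<sigma> ^^ i) x \<ominus> x [^] (n ^ i) \<in> Q"
      by (rule coset_eq_iff[OF Q_ideal, THEN iffD1]) (use x funpow_eigen[OF x eq] in auto)
    then have "(\<sigma> ^^ i) x \<ominus> x [^] (n ^ i) \<in> M" using Q_subset[OF M(1,3)] by blast
    then have "M +> (\<sigma> ^^ i) x = M +> x [^] (n ^ i)"
      by (intro coset_eq_iff[OF M(1), THEN iffD2]) (use x in auto)
    also have "\<dots> = (M +> x) [^]\<^bsub>R Quot M\<^esub> (n ^ i)" using x by simp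
    also have "\<dots> = M +> \<one>" unfolding xM by simp
    finally have "(\<sigma> ^^ i) x \<ominus> \<one> \<in> M"
      by (intro coset_eq_iff[OF M(1), THEN iffD1]) (use x in auto)
    then show ?thesis unfolding y_def using x by (simp add: a_minus_def)
  qed
  then have yJ: "y \<in> J" using yc by (auto simp: J_def)
  obtain D where D: "D > 0" "(\<sigma> ^^ D) x = x" using funpow_period[OF x] by blast
  \<comment> \<open>For this exponent, \<open>funpow_eigen\<close> and the period \<open>D\<close>
    make \<open>x\<close> and \<open>x [^] N\<close> agree modulo \<open>Q\<close>.\<close>
  define N where "N = n ^ D"
  obtain s where s: "s \<in> carrier R" "(\<one> \<oplus> y) [^] N = \<one> \<oplus> y \<otimes> s" "s \<ominus> [N] \<cdot> \<one> \<in> J"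
    using geometric_sum_mod[OF J yJ] by blast
  \<comment> \<open>This puts \<open>[N] \<cdot> \<one>\<close> into \<open>J\<close>, and with it
    \<open>s\<close>, which is congruent to it.\<close>
  have "p dvd N" unfolding N_def using D p_dvd by (simp add: dvd_power_le dvd_trans[OF _ dvd_power])
  then have NJ: "[N] \<cdot> \<one> \<in> J" by (rule add_pow_mem[OF J pJ])
  have "(s \<ominus> [N] \<cdot> \<one>) \<oplus> [N] \<cdot> \<one> = s"
    using s(1) add.nat_pow_closed[OF one_closed, of N] by algebra
  then have sJ: "s \<in> J"
    using additive_subgroup.a_closed[OF ideal.axioms(1)[OF J] s(3) NJ] by simp
  obtain k :: nat where k: "s [^] k \<in> Q"
    using stable_ideal_nil[OF J _ pJ stable sJ] JM M(2) by blast
  have "Q +> x = Q +> x [^] N" using funpow_eigen[OF x eq, of D] D unfolding N_def by simp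
  then have "x \<ominus> x [^] N \<in> Q"
    by (intro coset_eq_iff[OF Q_ideal, THEN iffD1]) (use x in auto)
  moreover have "x \<ominus> x [^] N = y \<ominus> y \<otimes> s"
    unfolding xy s(2) using yc s(1) by algebra
  ultimately have ys: "y \<ominus> y \<otimes> s \<in> Q" by simp
  \<comment> \<open>\<open>y\<close> equals \<open>y \<otimes> s\<close> modulo \<open>Q\<close>;
    iterating this replaces \<open>s\<close> by its powers, one of which lies in
    \<open>Q\<close>.\<close>
  have "y \<ominus> y \<otimes> s [^] j \<in> Q" for j :: nat
  proof (induction j)
    case 0
    have "y \<ominus> y \<otimes> s [^] (0::nat) = \<zero>" using yc by (simp add: a_minus_def r_neg)
    then show ?case using additive_subgroup.zero_closed[OF ideal.axioms(1)[OF Q_ideal]] by simp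
  next
    case (Suc j)
    define t where "t = s [^] j"
    have t: "t \<in> carrier R" using s(1) by (simp add: t_def)
    have "y \<ominus> y \<otimes> s [^] Suc j = (y \<ominus> y \<otimes> t) \<oplus> (y \<ominus> y \<otimes> s) \<otimes> t"
      unfolding nat_pow_Suc t_def[symmetric] using t yc s(1) by algebra
    then show ?case
      using Suc ideal.I_r_closed[OF Q_ideal ys t]
        additive_subgroup.a_closed[OF ideal.axioms(1)[OF Q_ideal]] by (simp add: t_def)
  qed
  then have "y \<ominus> y \<otimes> s [^] k \<in> Q" .
  moreover have "y \<otimes> s [^] k \<in> Q" using ideal.I_l_closed[OF Q_ideal k yc] .
  ultimately have "(y \<ominus> y \<otimes> s [^] k) \<oplus> y \<otimes> s [^] k \<in> Q"
    by (rule additive_subgroup.a_closed[OF ideal.axioms(1)[OF Q_ideal]])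
  moreover have "(y \<ominus> y \<otimes> s [^] k) \<oplus> y \<otimes> s [^] k = y"
    using yc nat_pow_closed[OF s(1), of k] by algebra
  ultimately show ?thesis by (simp add: y_def)
qed

section \<open>Counting units and solutions modulo \<open>Q\<close>\<close>

definition mod_units :: "'a set" where
  "mod_units = {a \<in> carrier R. \<exists>b\<in>carrier R. a \<otimes> b \<ominus> \<one> \<in> Q}"

text \<open>Like \<open>mod_units\<close>, it consists of ring elements instead of classes. Both
  sets are unions of cosets of \<open>Q\<close>, so their sizes carry a factor
  \<open>card Q\<close>, which cancels in \<open>density_le\<close>.\<close>

definition mod_eigen :: "'a set" where
  "mod_eigen = {a \<in> mod_units. \<sigma> a \<ominus> a [^] n \<in> Q}"

text \<open>The quotient of two solutions is again a solution and is \<open>\<one>\<close> modulo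
  \<open>M\<close>, so \<open>eigen_one_mod\<close> applies to it. It is formed as
  \<open>a \<otimes> b'\<close> with an inverse \<open>b'\<close> of \<open>b\<close> modulo
  \<open>Q\<close>.\<close>

lemma mod_eigen_inj:
  assumes M: "ideal M R" "\<one> \<notin> M" "[p] \<cdot> \<one> \<in> M"
    and a: "a \<in> mod_eigen" and b: "b \<in> mod_eigen" and ab: "a \<ominus> b \<in> M"
  shows "a \<ominus> b \<in> Q"
proof -
  interpret hQ: ring_hom_cring R "R Quot Q" "(+>) Q" by (rule quotient_hom[OF Q_ideal])
  note toQ = coset_eq_iff[OF Q_ideal, THEN iffD1] and toC = coset_eq_iff[OF Q_ideal, THEN iffD2]
  have ac: "a \<in> carrier R" and ea: "\<sigma> a \<ominus> a [^] n \<in> Q"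
    using a by (auto simp: mod_eigen_def mod_units_def)
  obtain b' where bc: "b \<in> carrier R" "b' \<in> carrier R" and bb: "b \<otimes> b' \<ominus> \<one> \<in> Q"
      and eb: "\<sigma> b \<ominus> b [^] n \<in> Q"
    using b by (auto simp: mod_eigen_def mod_units_def)
  have sb: "\<sigma> (b \<otimes> b') \<ominus> \<one> \<in> Q" using Q_stable[OF bb] bc by (simp add: hom_minus)
  define B where "B = Q +> b"
  define B' where "B' = Q +> b'"
  define T where "T = Q +> \<sigma> b'"
  define A where "A = Q +> a"
  have car: "A \<in> carrier (R Quot Q)" "B \<in> carrier (R Quot Q)" "B' \<in> carrier (R Quot Q)"
      "T \<in> carrier (R Quot Q)"
    using bc ac by (auto simp: B_def B'_def T_def A_def)
  have B1: "B \<otimes>\<^bsub>R Quot Q\<^esub> B' = \<one>\<^bsub>R Quot Q\<^esub>"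
    using toC[OF _ _ bb] bc by (simp add: B_def B'_def)
  have sB: "Q +> \<sigma> b = B [^]\<^bsub>R Quot Q\<^esub> n"
    using toC[OF _ _ eb] bc by (simp add: B_def)
  have sA: "Q +> \<sigma> a = A [^]\<^bsub>R Quot Q\<^esub> n"
    using toC[OF _ _ ea] ac by (simp add: A_def)
  \<comment> \<open>\<open>\<sigma> b'\<close> is inverse to \<open>\<sigma> b\<close> modulo
    \<open>Q\<close>, hence to the \<open>n\<close>-th power of \<open>b\<close>; uniqueness of
    inverses makes \<open>b'\<close> a solution too.\<close>
  have BT: "B [^]\<^bsub>R Quot Q\<^esub> n \<otimes>\<^bsub>R Quot Q\<^esub> T = \<one>\<^bsub>R Quot Q\<^esub>"
    using toC[OF _ _ sb] bc by (simp add: sB T_def)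
  have "B' [^]\<^bsub>R Quot Q\<^esub> n
      = B' [^]\<^bsub>R Quot Q\<^esub> n \<otimes>\<^bsub>R Quot Q\<^esub> (B [^]\<^bsub>R Quot Q\<^esub> n \<otimes>\<^bsub>R Quot Q\<^esub> T)"
    using car BT by simp
  also have "\<dots> = (B \<otimes>\<^bsub>R Quot Q\<^esub> B') [^]\<^bsub>R Quot Q\<^esub> n \<otimes>\<^bsub>R Quot Q\<^esub> T"
    using car by (simp add: hQ.S.nat_pow_distrib hQ.S.m_ac)
  also have "\<dots> = T" using car B1 by simp
  finally have T: "T = B' [^]\<^bsub>R Quot Q\<^esub> n" by simp
  define x where "x = a \<otimes> b'"
  have x: "x \<in> carrier R" using ac bc by (simp add: x_def)
  have "Q +> \<sigma> x = Q +> x [^] n"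
    using ac bc car sA T
    by (simp add: x_def hQ.S.nat_pow_distrib A_def[symmetric] B'_def[symmetric] T_def[symmetric])
  then have ex: "\<sigma> x \<ominus> x [^] n \<in> Q" by (rule toQ[rotated 2]) (use x in auto)
  have "(a \<ominus> b) \<otimes> b' \<oplus> (b \<otimes> b' \<ominus> \<one>) = x \<ominus> \<one>"
    unfolding x_def using ac bc by algebra
  moreover have "(a \<ominus> b) \<otimes> b' \<in> M" using ideal.I_r_closed[OF M(1) ab bc(2)] .
  moreover have "b \<otimes> b' \<ominus> \<one> \<in> M" using bb Q_subset[OF M(1,3)] by blast
  ultimately have "x \<ominus> \<one> \<in> M" using additive_subgroup.a_closed[OF ideal.axioms(1)[OF M(1)]] by metis
  then have x1: "x \<ominus> \<one> \<in> Q" using eigen_one_mod[OF M x ex] by blast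
  have "a \<ominus> b = (x \<ominus> \<one>) \<otimes> b \<ominus> a \<otimes> (b \<otimes> b' \<ominus> \<one>)"
    unfolding x_def using ac bc by algebra
  then show ?thesis
    using ideal_minus_closed[OF Q_ideal ideal.I_r_closed[OF Q_ideal x1 bc(1)]
        ideal.I_l_closed[OF Q_ideal bb ac]] by simp
qed

text \<open>By \<open>mod_eigen_inj\<close> the solutions over one residue class of \<open>M\<close>
  lie in a single coset of \<open>Q\<close>, so the class and the offset from a chosen solution in
  it determine a solution.\<close>

lemma card_mod_eigen:
  assumes M: "ideal M R" "\<one> \<notin> M" "[p] \<cdot> \<one> \<in> M"
  shows "card mod_eigen \<le> card ((+>) M ` mod_eigen) * card Q"
proof -
  define rep where "rep C = (SOME b. b \<in> mod_eigen \<and> M +> b = C)" for C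
  have rep: "rep (M +> a) \<in> mod_eigen" "M +> rep (M +> a) = M +> a" if "a \<in> mod_eigen" for a
    using someI[of "\<lambda>b. b \<in> mod_eigen \<and> M +> b = M +> a" a] that by (auto simp: rep_def)
  have sub: "mod_eigen \<subseteq> carrier R" by (auto simp: mod_eigen_def mod_units_def)
  let ?f = "\<lambda>a. (M +> a, a \<ominus> rep (M +> a))"
  have "a \<ominus> rep (M +> a) \<in> Q" if a: "a \<in> mod_eigen" for a
  proof (rule mod_eigen_inj[OF M a rep(1)[OF a]])
    show "a \<ominus> rep (M +> a) \<in> M"
      by (rule coset_eq_iff[OF M(1), THEN iffD1]) (use a rep[OF a] sub in auto)
  qed
  then have "?f ` mod_eigen \<subseteq> (+>) M ` mod_eigen \<times> Q" by auto
  moreover have "inj_on ?f mod_eigen"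
  proof (rule inj_onI)
    fix a b assume h: "a \<in> mod_eigen" "b \<in> mod_eigen" and eq: "?f a = ?f b"
    define c where "c = rep (M +> a)"
    have c: "c \<in> carrier R" "a \<in> carrier R" "b \<in> carrier R" using rep(1)[OF h(1)] h sub by (auto simp: c_def)
    have "a \<ominus> c = b \<ominus> c" using eq unfolding c_def by (metis prod.inject)
    then have "(a \<ominus> c) \<oplus> c = (b \<ominus> c) \<oplus> c" by simp
    moreover have "(a \<ominus> c) \<oplus> c = a" "(b \<ominus> c) \<oplus> c = b" using c by algebra+
    ultimately show "a = b" by simp
  qed
  moreover have "finite ((+>) M ` mod_eigen \<times> Q)"
    using finite_subset[OF sub fin] finite_subset[OF _ fin, of Q] ideal.Icarr[OF Q_ideal] by auto
  ultimately have "card mod_eigen \<le> card ((+>) M ` mod_eigen \<times> Q)"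
    by (intro card_inj_on_le)
  then show ?thesis by (simp add: card_cartesian_product)
qed

text \<open>Choosing for every unit class modulo \<open>p ^ v\<close> a unit \<open>s a\<close> of \<open>R\<close> in that class, the map
  \<open>(x, a) \<mapsto> (x * s a, x + (a - s a))\<close> is injective.\<close>

lemma card_eigen_lift:
  "card {x \<in> Units R. \<sigma> x = x [^] n} * card mod_units \<le> card (Units R) * card mod_eigen"
proof -
  let ?K = "{x \<in> Units R. \<sigma> x = x [^] n}"
  interpret hQ: ring_hom_cring R "R Quot Q" "(+>) Q" by (rule quotient_hom[OF Q_ideal])
  note toQ = coset_eq_iff[OF Q_ideal, THEN iffD1] and toC = coset_eq_iff[OF Q_ideal, THEN iffD2]
  \<comment> \<open>\<open>rep (Q +> a)\<close> is the unit called \<open>s a\<close> above; it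
    depends only on the coset of \<open>a\<close>.\<close>
  define rep where "rep C = (SOME u. u \<in> Units R \<and> Q +> u = C)" for C
  have rep: "rep (Q +> a) \<in> Units R" "Q +> rep (Q +> a) = Q +> a" if a: "a \<in> mod_units" for a
  proof -
    obtain u where "u \<in> Units R" "u \<ominus> a \<in> Q"
      using units_lift[OF fin Q_ideal, of a] a by (auto simp: mod_units_def)
    then have "u \<in> Units R \<and> Q +> u = Q +> a"
      using a toC[of u a] by (auto simp: mod_units_def)
    then show "rep (Q +> a) \<in> Units R" "Q +> rep (Q +> a) = Q +> a"
      using someI[of "\<lambda>b. b \<in> Units R \<and> Q +> b = Q +> a" u] by (auto simp: rep_def)
  qed
  have subW: "mod_units \<subseteq> carrier R" by (auto simp: mod_units_def)
  define f where "f = (\<lambda>(x, a). (x \<otimes> rep (Q +> a), x \<oplus> (a \<ominus> rep (Q +> a))))"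
  have cong: "Q +> (x \<oplus> (a \<ominus> rep (Q +> a))) = Q +> x" if x: "x \<in> carrier R" and a: "a \<in> mod_units" for x a
  proof -
    define u where "u = rep (Q +> a)"
    have u: "u \<in> carrier R" "Q +> u = Q +> a" and ac: "a \<in> carrier R"
      using rep[OF a] a subW by (auto simp: u_def)
    have "a \<ominus> u \<in> Q" by (rule toQ) (use u ac in auto)
    moreover have "(x \<oplus> (a \<ominus> u)) \<ominus> x = a \<ominus> u" using x u(1) ac by algebra
    ultimately show ?thesis unfolding u_def[symmetric] by (intro toC) (use x u ac in auto)
  qed
  have "inj_on f (?K \<times> mod_units)"
  proof (rule inj_onI, clarify)
    fix x a x' a'
    assume h: "x \<in> Units R" "a \<in> mod_units" "x' \<in> Units R" "a' \<in> mod_units"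
      and eq: "f (x, a) = f (x', a')"
    define u where "u = rep (Q +> a)"
    define u' where "u' = rep (Q +> a')"
    have u: "u \<in> Units R" "u' \<in> Units R" "Q +> u = Q +> a" "Q +> u' = Q +> a'"
      using rep h by (auto simp: u_def u'_def)
    have c: "x \<in> carrier R" "x' \<in> carrier R" "a \<in> carrier R" "a' \<in> carrier R"
      "u \<in> carrier R" "u' \<in> carrier R"
      using h u(1,2) subW by auto
    have e1: "x \<otimes> u = x' \<otimes> u'" and e2: "x \<oplus> (a \<ominus> u) = x' \<oplus> (a' \<ominus> u')"
      using eq by (simp_all add: f_def u_def u'_def)
    have "Q +> x = Q +> x'"
      using cong[OF c(1) h(2)] cong[OF c(2) h(4)] e2 by (simp add: u_def u'_def)
    then have "x \<ominus> x' \<in> Q" by (rule toQ[OF c(1,2)])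
    \<comment> \<open>As \<open>x\<close> and \<open>x'\<close> agree modulo \<open>Q\<close>, the
      equation \<open>x \<otimes> u = x' \<otimes> u'\<close> puts \<open>u\<close> and
      \<open>u'\<close> into the same coset. They are then equal, being the chosen units of their
      cosets.\<close>
    then have "inv x' \<otimes> ((x \<ominus> x') \<otimes> u) \<in> Q"
      using h c ideal.I_l_closed[OF Q_ideal] ideal.I_r_closed[OF Q_ideal] by (metis Units_inv_closed)
    moreover have "inv x' \<otimes> ((x \<ominus> x') \<otimes> u) = u' \<ominus> u"
    proof -
      have iv: "inv x' \<in> carrier R" "inv x' \<otimes> x' = \<one>" using h by auto
      have "inv x' \<otimes> ((x \<ominus> x') \<otimes> u) = inv x' \<otimes> (x \<otimes> u) \<ominus> (inv x' \<otimes> x') \<otimes> u"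
        using iv(1) c by algebra
      also have "\<dots> = (inv x' \<otimes> x') \<otimes> u' \<ominus> (inv x' \<otimes> x') \<otimes> u"
        unfolding e1 using iv(1) c by algebra
      also have "\<dots> = u' \<ominus> u" unfolding iv(2) using c by simp
      finally show ?thesis .
    qed
    ultimately have "Q +> u' = Q +> u" by (intro toC) (use c in auto)
    then have "Q +> a = Q +> a'" using u by simp
    then have uu: "u = u'" by (simp add: u_def u'_def)
    then have xx: "x = x'" using e1 Units_l_cancel[OF u(2) c(1,2)] m_comm c by metis
    have "(x \<oplus> (a \<ominus> u)) \<oplus> (u \<ominus> x) = a" "(x \<oplus> (a' \<ominus> u)) \<oplus> (u \<ominus> x) = a'"
      using c by algebra+
    then show "x = x' \<and> a = a'" using e2 uu xx by metis
  qed
  moreover have "f ` (?K \<times> mod_units) \<subseteq> Units R \<times> mod_eigen"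
  proof clarify
    fix x a y w assume h: "x \<in> Units R" "\<sigma> x = x [^] n" "a \<in> mod_units" and eq: "(y, w) = f (x, a)"
    have xc: "x \<in> carrier R" and ac: "a \<in> carrier R" using h subW by auto
    have y: "y = x \<otimes> rep (Q +> a)" and w: "w = x \<oplus> (a \<ominus> rep (Q +> a))"
      using eq by (auto simp: f_def)
    have wc: "w \<in> carrier R" using w xc ac rep(1)[OF h(3)] by auto
    have wx: "Q +> w = Q +> x" unfolding w by (rule cong[OF xc h(3)])
    then have wxQ: "w \<ominus> x \<in> Q" by (rule toQ[OF wc xc])
    have iv: "inv x \<in> carrier R" "x \<otimes> inv x = \<one>" using h by auto
    have "w \<otimes> inv x \<ominus> x \<otimes> inv x = (w \<ominus> x) \<otimes> inv x" using wc xc iv(1) by algebra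
    then have "w \<otimes> inv x \<ominus> \<one> \<in> Q" using ideal.I_r_closed[OF Q_ideal wxQ iv(1)] iv(2) by simp
    then have "w \<in> mod_units" using wc h(1) by (auto simp: mod_units_def)
    moreover have "\<sigma> w \<ominus> \<sigma> x \<in> Q" using Q_stable[OF wxQ] wc xc by (simp add: hom_minus)
    then have "Q +> \<sigma> w = Q +> \<sigma> x" by (intro toC) (use wc xc in auto)
    then have "Q +> \<sigma> w = Q +> w [^] n" using wx wc xc h(2) by simp
    then have "\<sigma> w \<ominus> w [^] n \<in> Q" by (rule toQ[rotated 2]) (use wc in auto)
    ultimately have "w \<in> mod_eigen" by (simp add: mod_eigen_def)
    then show "y \<in> Units R \<and> w \<in> mod_eigen" using y h(1) rep(1)[OF h(3)] by auto
  qed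
  moreover have "finite (Units R \<times> mod_eigen)"
    using fin by (intro finite_cartesian_product)
      (auto intro: finite_subset[of _ "carrier R"] simp: mod_eigen_def mod_units_def)
  ultimately have "card (?K \<times> mod_units) \<le> card (Units R \<times> mod_eigen)"
    by (rule card_inj_on_le)
  then show ?thesis by (simp add: card_cartesian_product)
qed

end

section \<open>Solutions in the residue field\<close>

lemma (in cring) card_quotient:
  assumes "ideal I R"
  shows "card (carrier (R Quot I)) * card I = card (carrier R)"
proof -
  have "subgroup I (add_monoid R)"
    using assms by (simp add: additive_subgroup.a_subgroup ideal.axioms(1))
  then show ?thesis
    using add.lagrange[of I] by (simp add: FactRing_def A_RCOSETS_def order_def)
qed

lemma (in cring) coset_exists:
  assumes "C \<in> carrier (R Quot I)"
  shows "\<exists>x\<in>carrier R. C = I +> x"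
  using assms by (auto simp: FactRing_simps)

lemma (in cring) card_ideal_dvd:
  assumes "ideal I R" "ideal J R" "I \<subseteq> J"
  shows "card I dvd card J"
proof -
  interpret J: group "(add_monoid R)\<lparr>carrier := J\<rparr>"
    using assms by (intro add.subgroup_imp_group) (simp add: additive_subgroup.a_subgroup ideal.axioms(1))
  have "subgroup I ((add_monoid R)\<lparr>carrier := J\<rparr>)"
    using assms by (intro add.subgroup_incl) (simp_all add: additive_subgroup.a_subgroup ideal.axioms(1))
  from J.lagrange[OF this] show ?thesis by (simp add: order_def) (metis dvd_triv_right)
qed

context cyclic_algebra_mod
begin

lemma p_ideal: "ideal (PIdl ([p] \<cdot> \<one>)) R"
  by (intro cgenideal_ideal) simp

lemma card_p_ideal: "card (PIdl ([p] \<cdot> \<one>)) * p ^ d = card (carrier R)" "card (PIdl ([p] \<cdot> \<one>)) > 0"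
proof -
  show *: "card (PIdl ([p] \<cdot> \<one>)) * p ^ d = card (carrier R)"
    by (rule card_ideal[OF p_dvd])
  have "card (carrier R) > 0" using fin one_closed card_gt_0_iff by blast
  then show "card (PIdl ([p] \<cdot> \<one>)) > 0" using * by (intro gr0I) simp
qed

lemma p_ideal_subset:
  assumes M: "ideal M R" "[p] \<cdot> \<one> \<in> M" shows "PIdl ([p] \<cdot> \<one>) \<subseteq> M"
  using ideal.I_l_closed[OF M] by (auto simp: cgenideal_def)

text \<open>The index of \<open>M\<close> divides the index \<open>p ^ d\<close> of the smaller
  ideal generated by \<open>p\<close>.\<close>

lemma card_residue_dvd:
  assumes M: "ideal M R" "[p] \<cdot> \<one> \<in> M"
  shows "card (carrier (R Quot M)) dvd p ^ d"
proof -
  obtain c where c: "card M = card (PIdl ([p] \<cdot> \<one>)) * c"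
    using card_ideal_dvd[OF p_ideal M(1) p_ideal_subset[OF M]] by blast
  have "card (carrier (R Quot M)) * (card (PIdl ([p] \<cdot> \<one>)) * c) = card (PIdl ([p] \<cdot> \<one>)) * p ^ d"
    using card_quotient[OF M(1)] card_p_ideal(1) c by simp
  then have "card (PIdl ([p] \<cdot> \<one>)) * (card (carrier (R Quot M)) * c) = card (PIdl ([p] \<cdot> \<one>)) * p ^ d"
    by (simp add: mult_ac)
  then have "card (carrier (R Quot M)) * c = p ^ d" using card_p_ideal(2) by simp
  then show ?thesis by (metis dvd_triv_left)
qed

text \<open>\<open>M\<close> and its preimage under \<open>\<sigma>\<close> are different maximal
  ideals, so by the Chinese remainder theorem \<open>x\<close> and \<open>\<sigma> x\<close> take
  independent arbitrary values modulo \<open>M\<close>. Both values depend only on \<open>x\<close>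
  modulo \<open>p\<close>, which leaves \<open>p ^ d\<close> possibilities.\<close>

lemma residue_moved:
  assumes M: "maximalideal M R" "[p] \<cdot> \<one> \<in> M"
    and w: "w \<in> carrier R" "\<sigma> w \<in> M" "w \<notin> M"
  shows "(card (carrier (R Quot M)))\<^sup>2 \<le> p ^ d"
proof -
  let ?k = "R Quot M" and ?P = "PIdl ([p] \<cdot> \<one>)"
  have I: "ideal M R" using M by (simp add: maximalideal.axioms(1))
  interpret k: field ?k using maximalideal.quotient_is_field[OF M(1) is_cring] .
  interpret h: ring_hom_cring R ?k "(+>) M" by (rule quotient_hom[OF I])
  have zero: "M +> z = \<zero>\<^bsub>?k\<^esub> \<longleftrightarrow> z \<in> M" if "z \<in> carrier R" for z
    using coset_eq_iff[OF I that zero_closed] that by (simp add: a_minus_def)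
  obtain C where C: "C \<in> carrier ?k" "(M +> w) \<otimes>\<^bsub>?k\<^esub> C = \<one>\<^bsub>?k\<^esub>"
    using k.field_Units zero[OF w(1)] w by (metis Diff_iff h.hom_closed k.Units_inv_closed k.Units_r_inv singletonD)
  obtain w' where w': "w' \<in> carrier R" "C = M +> w'" using coset_exists[OF C(1)] by blast
  \<comment> \<open>\<open>e\<close> is \<open>\<one>\<close> modulo \<open>M\<close> while
    \<open>\<sigma> e\<close> lies in \<open>M\<close>: it separates the two conditions.\<close>
  define e where "e = w \<otimes> w'"
  have e: "e \<in> carrier R" "M +> e = \<one>\<^bsub>?k\<^esub>" using w w' C by (auto simp: e_def)
  have "\<sigma> e \<in> M" using w w' ideal.I_r_closed[OF I w(2)] by (simp add: e_def)
  then have se: "M +> \<sigma> e = \<zero>\<^bsub>?k\<^esub>" using zero e by simp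
  have ex: "\<exists>x\<in>carrier R. M +> x = C \<and> M +> \<sigma> x = D"
    if CD: "C \<in> carrier ?k" "D \<in> carrier ?k" for C D
  proof -
    obtain a where a: "a \<in> carrier R" "C = M +> a" using coset_exists[OF CD(1)] by blast
    obtain b where b: "b \<in> carrier R" "D = M +> b" using coset_exists[OF CD(2)] by blast
    obtain b0 where b0: "b0 \<in> carrier R" "\<sigma> b0 = b" using \<sigma>_bij b by (metis bij_betw_def image_iff)
    \<comment> \<open>Modulo \<open>M\<close> only the first summand survives; after applying
      \<open>\<sigma>\<close>, only the second, which becomes \<open>b\<close>.\<close>
    let ?x = "a \<otimes> e \<oplus> b0 \<otimes> (\<one> \<ominus> e)"
    have "M +> ?x = C" "M +> \<sigma> ?x = D"
      using a b(1) b0 e se CD b(2) by (simp_all add: a_minus_def k.r_neg)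
    then show ?thesis using a b0 e by blast
  qed
  define g where "g C D = (SOME x. x \<in> carrier R \<and> M +> x = C \<and> M +> \<sigma> x = D)" for C D
  have g: "g C D \<in> carrier R" "M +> g C D = C" "M +> \<sigma> (g C D) = D"
    if "C \<in> carrier ?k" "D \<in> carrier ?k" for C D
    using someI_ex[of "\<lambda>x. x \<in> carrier R \<and> M +> x = C \<and> M +> \<sigma> x = D"] ex[OF that]
    unfolding g_def by blast+
  have PM: "?P \<subseteq> M" by (rule p_ideal_subset[OF I M(2)])
  have Pc: "?P \<subseteq> carrier R" using ideal.Icarr[OF p_ideal] by auto
  have sP: "\<sigma> z \<in> M" if z: "z \<in> ?P" for z
  proof -
    obtain y where "y \<in> carrier R" "z = y \<otimes> [p] \<cdot> \<one>" using z by (auto simp: cgenideal_def)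
    then show ?thesis using ideal.I_l_closed[OF I M(2)] by (simp add: hom_add_pow)
  qed
  \<comment> \<open>The chosen lift of each pair is shifted by elements of \<open>?P\<close>, which
    change neither residue.\<close>
  let ?f = "\<lambda>((C, D), z). g C D \<oplus> z"
  have val: "M +> (g C D \<oplus> z) = C" "M +> \<sigma> (g C D \<oplus> z) = D"
    if "C \<in> carrier ?k" "D \<in> carrier ?k" "z \<in> ?P" for C D z
  proof -
    have zc: "z \<in> carrier R" using that Pc by auto
    have "M +> z = \<zero>\<^bsub>?k\<^esub>" "M +> \<sigma> z = \<zero>\<^bsub>?k\<^esub>" using zero sP PM that zc by auto
    then show "M +> (g C D \<oplus> z) = C" "M +> \<sigma> (g C D \<oplus> z) = D"
      using g[OF that(1,2)] zc that by simp_all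
  qed
  have "inj_on ?f ((carrier ?k \<times> carrier ?k) \<times> ?P)"
  proof (rule inj_onI)
    fix t1 t2
    assume t12: "t1 \<in> (carrier ?k \<times> carrier ?k) \<times> ?P" "t2 \<in> (carrier ?k \<times> carrier ?k) \<times> ?P"
      and ft12: "?f t1 = ?f t2"
    obtain C D z C' D' z' where t1: "t1 = ((C, D), z)" and t2: "t2 = ((C', D'), z')"
      by (metis prod.exhaust)
    have m: "C \<in> carrier ?k" "D \<in> carrier ?k" "z \<in> ?P" "C' \<in> carrier ?k" "D' \<in> carrier ?k" "z' \<in> ?P"
      and eq: "g C D \<oplus> z = g C' D' \<oplus> z'"
      using t12 ft12 by (auto simp: t1 t2)
    have CD: "C = C'" "D = D'" using val[OF m(1-3)] val[OF m(4-6)] eq by auto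
    moreover have "z \<in> carrier R" "z' \<in> carrier R" using m Pc by auto
    ultimately show "t1 = t2" using eq g[OF m(1,2)] by (simp add: t1 t2)
  qed
  moreover have "?f ` ((carrier ?k \<times> carrier ?k) \<times> ?P) \<subseteq> carrier R"
    using g(1) Pc by auto
  ultimately have "card ((carrier ?k \<times> carrier ?k) \<times> ?P) \<le> card (carrier R)"
    using fin by (rule card_inj_on_le)
  then have "(card (carrier ?k))\<^sup>2 * card ?P \<le> p ^ d * card ?P"
    using card_p_ideal(1) by (simp add: card_cartesian_product power2_eq_square mult.commute)
  then show ?thesis using card_p_ideal(2) by simp
qed

text \<open>\<open>\<sigma>\<close> induces an automorphism of the residue field. It sends a
  generator of the cyclic multiplicative group to some power of it, hence every element to its power
  with the same exponent. Since this power map is additive, \<open>additive_power_map\<close> makes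
  the exponent a power of \<open>p\<close>.\<close>

lemma residue_frobenius:
  assumes M: "maximalideal M R" "[p] \<cdot> \<one> \<in> M"
    and stable: "\<And>w. w \<in> carrier R \<Longrightarrow> \<sigma> w \<in> M \<longleftrightarrow> w \<in> M"
  shows "\<exists>a. p ^ a < card (carrier (R Quot M)) \<and>
    (\<forall>x\<in>carrier R. M +> \<sigma> x = (M +> x) [^]\<^bsub>R Quot M\<^esub> (p ^ a))"
proof -
  let ?k = "R Quot M"
  have I: "ideal M R" using M by (simp add: maximalideal.axioms(1))
  interpret k: field ?k using maximalideal.quotient_is_field[OF M(1) is_cring] .
  interpret h: ring_hom_cring R ?k "(+>) M" by (rule quotient_hom[OF I])
  note toI = coset_eq_iff[OF I, THEN iffD1] and toC = coset_eq_iff[OF I, THEN iffD2]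
  have zero: "M +> z = \<zero>\<^bsub>?k\<^esub> \<longleftrightarrow> z \<in> M" if "z \<in> carrier R" for z
    using coset_eq_iff[OF I that zero_closed] that by (simp add: a_minus_def)
  have kfin: "finite (carrier ?k)"
    using fin coset_exists by (intro finite_surj[of "carrier R" _ "(+>) M"]) auto
  obtain \<gamma> where \<gamma>: "\<gamma> \<in> carrier ?k" "\<gamma> \<noteq> \<zero>\<^bsub>?k\<^esub>"
    and gen: "carrier ?k - {\<zero>\<^bsub>?k\<^esub>} = {\<gamma> [^]\<^bsub>?k\<^esub> i | i::nat. i \<in> UNIV}"
    using k.finite_field_mult_group_has_gen[OF kfin] by auto
  interpret G: group "Multiplicative_Group.mult_of ?k" by (rule k.field_mult_group)
  have order: "order (Multiplicative_Group.mult_of ?k) = card (carrier ?k) - 1"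
    using k.order_mult_of[OF kfin] by (simp add: order_def)
  obtain c where c: "c \<in> carrier R" "\<gamma> = M +> c" using coset_exists[OF \<gamma>(1)] by blast
  have "c \<notin> M" using \<gamma> c zero by auto
  then have "M +> \<sigma> c \<in> carrier ?k - {\<zero>\<^bsub>?k\<^esub>}" using stable[OF c(1)] zero c by simp
  then obtain i :: nat where i: "M +> \<sigma> c = \<gamma> [^]\<^bsub>?k\<^esub> i" using gen by blast
  define N where "N = card (carrier ?k) - 1"
  have N1: "\<gamma> [^]\<^bsub>?k\<^esub> N = \<one>\<^bsub>?k\<^esub>"
    using G.pow_order_eq_1[of \<gamma>] \<gamma> order by (simp add: N_def Multiplicative_Group.nat_pow_mult_of)
  have "card {\<zero>\<^bsub>?k\<^esub>, \<one>\<^bsub>?k\<^esub>} \<le> card (carrier ?k)" using kfin by (intro card_mono) auto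
  then have N0: "N > 0" by (simp add: N_def)
  \<comment> \<open>The exponent is reduced modulo the group order \<open>N\<close> into the range
    from \<open>1\<close> to \<open>N\<close>: positive, so that zero goes to zero, and below the
    size of the field, as \<open>additive_power_map\<close> demands.\<close>
  define s where "s = (if i mod N = 0 then N else i mod N)"
  have "\<gamma> [^]\<^bsub>?k\<^esub> i = \<gamma> [^]\<^bsub>?k\<^esub> (N * (i div N)) \<otimes>\<^bsub>?k\<^esub> \<gamma> [^]\<^bsub>?k\<^esub> (i mod N)"
    using \<gamma> by (simp add: k.nat_pow_mult)
  also have "\<dots> = \<gamma> [^]\<^bsub>?k\<^esub> s"
    using \<gamma> N1 by (auto simp: k.nat_pow_pow[symmetric] s_def)
  finally have sc: "M +> \<sigma> c = \<gamma> [^]\<^bsub>?k\<^esub> s" using i by simp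
  have s: "0 < s" "s < card (carrier ?k)"
  proof -
    have "i mod N < N" using N0 by simp
    moreover have "N < card (carrier ?k)" using N0 by (simp add: N_def)
    ultimately have "i mod N < card (carrier ?k)" "N < card (carrier ?k)" by linarith+
    then show "0 < s" "s < card (carrier ?k)" using N0 by (auto simp: s_def)
  qed
  have act: "M +> \<sigma> x = (M +> x) [^]\<^bsub>?k\<^esub> s" if x: "x \<in> carrier R" for x
  proof (cases "x \<in> M")
    case True
    then have "M +> \<sigma> x = \<zero>\<^bsub>?k\<^esub>" "M +> x = \<zero>\<^bsub>?k\<^esub>" using stable x zero by auto
    then show ?thesis using s by (simp add: k.nat_pow_zero)
  next
    case False
    then have "M +> x \<in> carrier ?k - {\<zero>\<^bsub>?k\<^esub>}" using x zero by simp
    then obtain j :: nat where j: "M +> x = \<gamma> [^]\<^bsub>?k\<^esub> j" using gen by blast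
    then have "M +> x = M +> c [^] j" using c by simp
    then have "x \<ominus> c [^] j \<in> M" by (rule toI[rotated 2]) (use x c in auto)
    then have "\<sigma> (x \<ominus> c [^] j) \<in> M"
      using stable[of "x \<ominus> c [^] j"] x c by blast
    then have "\<sigma> x \<ominus> \<sigma> c [^] j \<in> M" using x c by (simp add: hom_minus)
    then have "M +> \<sigma> x = M +> \<sigma> c [^] j" by (intro toC) (use x c in auto)
    also have "\<dots> = (\<gamma> [^]\<^bsub>?k\<^esub> s) [^]\<^bsub>?k\<^esub> j" using sc c by simp
    also have "\<dots> = (M +> x) [^]\<^bsub>?k\<^esub> s" using \<gamma> j by (simp add: k.nat_pow_pow mult.commute)
    finally show ?thesis .
  qed
  have pk: "[p] \<cdot>\<^bsub>?k\<^esub> \<one>\<^bsub>?k\<^esub> = \<zero>\<^bsub>?k\<^esub>"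
  proof -
    have "M +> [j] \<cdot> \<one> = [j] \<cdot>\<^bsub>?k\<^esub> \<one>\<^bsub>?k\<^esub>" for j :: nat by (induction j) auto
    then show ?thesis using zero[of "[p] \<cdot> \<one>"] M(2) by simp
  qed
  have "\<exists>a. s = p ^ a"
  proof (rule k.additive_power_map[OF kfin p pk s])
    fix t assume "t \<in> carrier ?k"
    then obtain x where x: "x \<in> carrier R" "t = M +> x" using coset_exists by blast
    show "(t \<oplus>\<^bsub>?k\<^esub> \<one>\<^bsub>?k\<^esub>) [^]\<^bsub>?k\<^esub> s = t [^]\<^bsub>?k\<^esub> s \<oplus>\<^bsub>?k\<^esub> \<one>\<^bsub>?k\<^esub>"
      using act[of "x \<oplus> \<one>"] act[of x] x by simp
  qed
  then show ?thesis using act s by blast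
qed

text \<open>Squaring keeps the factor \<open>p ^ (d / 2)\<close> within the natural numbers for odd
  \<open>d\<close>.\<close>

lemma residue_eigen_bound:
  assumes M: "maximalideal M R" "[p] \<cdot> \<one> \<in> M"
  shows "(card ((+>) M ` mod_eigen))\<^sup>2 \<le> n\<^sup>2 * p ^ d"
proof -
  let ?k = "R Quot M" and ?T = "(+>) M ` mod_eigen"
  have I: "ideal M R" using M by (simp add: maximalideal.axioms(1))
  interpret k: field ?k using maximalideal.quotient_is_field[OF M(1) is_cring] .
  interpret h: ring_hom_cring R ?k "(+>) M" by (rule quotient_hom[OF I])
  have zero: "M +> z = \<zero>\<^bsub>?k\<^esub> \<longleftrightarrow> z \<in> M" if "z \<in> carrier R" for z
    using coset_eq_iff[OF I that zero_closed] that by (simp add: a_minus_def)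
  have kfin: "finite (carrier ?k)"
    using fin coset_exists by (intro finite_surj[of "carrier R" _ "(+>) M"]) auto
  have p1: "p > 1" using p prime_gt_1_nat by blast
  have one: "\<one> \<notin> M"
    using ideal.one_imp_carrier[OF I] maximalideal.I_notcarr[OF M(1)] by auto
  have Tk: "?T \<subseteq> carrier ?k" by (auto simp: mod_eigen_def mod_units_def)
  have sq: "(card ?T)\<^sup>2 \<le> n\<^sup>2 * p ^ d" if "card ?T \<le> m" "m\<^sup>2 \<le> n\<^sup>2 * p ^ d" for m
    using that by (meson power_mono order_trans zero_le)
  show ?thesis
  proof (cases "\<exists>w\<in>carrier R. \<sigma> w \<in> M \<and> w \<notin> M")
    case True
    then have "(card (carrier ?k))\<^sup>2 \<le> p ^ d" using residue_moved[OF M] by blast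
    also have "\<dots> \<le> n\<^sup>2 * p ^ d" using n3 by simp
    finally show ?thesis using card_mono[OF kfin Tk] sq by blast
  next
    case False
    \<comment> \<open>In this case the preimage of \<open>M\<close> is contained in
      \<open>M\<close>; having the same finite size it equals \<open>M\<close>, which is the
      stability that \<open>residue_frobenius\<close> asks for.\<close>
    define M' where "M' = {w \<in> carrier R. \<sigma> w \<in> M}"
    have "M' \<subseteq> M" using False by (auto simp: M'_def)
    moreover have "card M' = card M"
    proof (rule bij_betw_same_card[of \<sigma>])
      have "\<sigma> ` M' = M"
      proof
        show "\<sigma> ` M' \<subseteq> M" by (auto simp: M'_def)
        show "M \<subseteq> \<sigma> ` M'"
        proof
          fix z assume z: "z \<in> M"
          then have "z \<in> \<sigma> ` carrier R" using \<sigma>_bij ideal.Icarr[OF I z] by (simp add: bij_betw_def)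
          then show "z \<in> \<sigma> ` M'" using z by (auto simp: M'_def)
        qed
      qed
      moreover have "inj_on \<sigma> M'"
        using \<sigma>_bij by (auto simp: bij_betw_def M'_def intro: inj_on_subset)
      ultimately show "bij_betw \<sigma> M' M" by (simp add: bij_betw_def)
    qed
    moreover have "finite M" using finite_subset[OF _ fin, of M] ideal.Icarr[OF I] by auto
    ultimately have "M' = M" using card_subset_eq by blast
    then have "\<sigma> w \<in> M \<longleftrightarrow> w \<in> M" if "w \<in> carrier R" for w
      using that by (auto simp: M'_def)
    then obtain a where a: "p ^ a < card (carrier ?k)"
      and act: "\<And>x. x \<in> carrier R \<Longrightarrow> M +> \<sigma> x = (M +> x) [^]\<^bsub>?k\<^esub> (p ^ a)"
      using residue_frobenius[OF M] by blast
    obtain f where f: "f \<le> d" "card (carrier ?k) = p ^ f"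
      using card_residue_dvd[OF I M(2)] p by (metis divides_primepow_nat)
    have af: "a < f" using a f p1 by (simp add: power_strict_increasing_iff)
    have T: "t \<in> carrier ?k \<and> t \<noteq> \<zero>\<^bsub>?k\<^esub> \<and> t [^]\<^bsub>?k\<^esub> (p ^ a) = t [^]\<^bsub>?k\<^esub> n" if "t \<in> ?T" for t
    proof -
      obtain x where xe: "x \<in> mod_eigen" and t: "t = M +> x" using \<open>t \<in> ?T\<close> by blast
      obtain y where x: "x \<in> carrier R" and y: "y \<in> carrier R" and xy: "x \<otimes> y \<ominus> \<one> \<in> Q"
        and ex: "\<sigma> x \<ominus> x [^] n \<in> Q"
        using xe by (auto simp: mod_eigen_def mod_units_def)
      have QM: "Q \<subseteq> M" by (rule Q_subset[OF I M(2)])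
      have "x \<notin> M"
      proof
        assume "x \<in> M"
        then have "x \<otimes> y \<in> M" using ideal.I_r_closed[OF I] y by blast
        then have "x \<otimes> y \<ominus> (x \<otimes> y \<ominus> \<one>) \<in> M" using ideal_minus_closed[OF I] xy QM by blast
        moreover have "x \<otimes> y \<ominus> (x \<otimes> y \<ominus> \<one>) = \<one>" using x y by algebra
        ultimately show False using one by simp
      qed
      moreover have "M +> \<sigma> x = M +> x [^] n"
        by (rule coset_eq_iff[OF I, THEN iffD2]) (use x ex QM in auto)
      ultimately show ?thesis using act[OF x] x zero by (simp add: t)
    qed
    have pow_one: "t [^]\<^bsub>?k\<^esub> (j - i) = \<one>\<^bsub>?k\<^esub>"
      if t: "t \<in> carrier ?k" "t \<noteq> \<zero>\<^bsub>?k\<^esub>" and ij: "i \<le> j" "t [^]\<^bsub>?k\<^esub> i = t [^]\<^bsub>?k\<^esub> j" for t and i j :: nat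
    proof -
      have "t [^]\<^bsub>?k\<^esub> i \<otimes>\<^bsub>?k\<^esub> t [^]\<^bsub>?k\<^esub> (j - i) = t [^]\<^bsub>?k\<^esub> i \<otimes>\<^bsub>?k\<^esub> \<one>\<^bsub>?k\<^esub>"
        using t ij(1) ij(2)[symmetric] by (simp add: k.nat_pow_mult)
      moreover have "t [^]\<^bsub>?k\<^esub> i \<noteq> \<zero>\<^bsub>?k\<^esub>" 
        by (induction i) (use t in \<open>auto simp: k.integral_iff\<close>)
      ultimately show ?thesis
        using t k.m_lcancel[of "t [^]\<^bsub>?k\<^esub> i" "t [^]\<^bsub>?k\<^esub> (j - i)" "\<one>\<^bsub>?k\<^esub>"]
        by (metis k.nat_pow_closed k.one_closed)
    qed
    have bound: "card ?T \<le> m" if "m > 0" "\<And>t. t \<in> ?T \<Longrightarrow> t [^]\<^bsub>?k\<^esub> m = \<one>\<^bsub>?k\<^esub>" for m :: nat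
    proof -
      have "?T \<subseteq> {t \<in> carrier ?k. t [^]\<^bsub>?k\<^esub> m = \<one>\<^bsub>?k\<^esub>}" using that(2) Tk by blast
      then have "card ?T \<le> card {t \<in> carrier ?k. t [^]\<^bsub>?k\<^esub> m = \<one>\<^bsub>?k\<^esub>}" using kfin by (intro card_mono) auto
      also have "\<dots> \<le> m" using k.num_roots_le_deg[OF kfin] that(1) by simp
      finally show ?thesis .
    qed
    show ?thesis
    \<comment> \<open>The available exponents are at most \<open>n * p ^ a\<close> and
      \<open>n * p ^ (f - a)\<close>; the one with the smaller power of \<open>p\<close> is taken,
      and \<open>f \<le> d\<close>.\<close>
    proof (cases "2 * a \<le> f")
      case True
      \<comment> \<open>\<open>a = 0\<close> is excluded by size, positive \<open>a\<close> because
        \<open>n\<close> is not a prime power.\<close>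
      have neq: "n \<noteq> p ^ a"
      proof (cases a)
        case 0 then show ?thesis using n3 by simp
      next
        case (Suc _) then show ?thesis using not_primepow p unfolding primepow_def by blast
      qed
      define m where "m = (if n \<le> p ^ a then p ^ a - n else n - p ^ a)"
      have "m > 0" using neq by (auto simp: m_def)
      moreover have "t [^]\<^bsub>?k\<^esub> m = \<one>\<^bsub>?k\<^esub>" if "t \<in> ?T" for t
        using T[OF that] pow_one[of t n "p ^ a"] pow_one[of t "p ^ a" n] by (auto simp: m_def)
      ultimately have "card ?T \<le> m" by (rule bound)
      also have "m \<le> n * p ^ a"
      proof -
        have "n \<le> n * p ^ a" "p ^ a \<le> n * p ^ a" using p1 n3 by simp_all
        moreover have "m \<le> n \<or> m \<le> p ^ a" by (auto simp: m_def)
        ultimately show ?thesis by linarith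
      qed
      finally have "card ?T \<le> n * p ^ a" .
      moreover have "(n * p ^ a)\<^sup>2 \<le> n\<^sup>2 * p ^ d"
      proof -
        have "p ^ (2 * a) \<le> p ^ d" using True f p1 by (intro power_increasing) auto
        then show ?thesis by (simp add: power_mult_distrib power_mult[symmetric] mult.commute)
      qed
      ultimately show ?thesis by (rule sq)
    next
      case False
      interpret G: group "Multiplicative_Group.mult_of ?k" by (rule k.field_mult_group)
      have full: "t [^]\<^bsub>?k\<^esub> (p ^ f) = t" if t: "t \<in> carrier ?k" "t \<noteq> \<zero>\<^bsub>?k\<^esub>" for t
      proof -
        have "t [^]\<^bsub>?k\<^esub> (p ^ f - 1) = \<one>\<^bsub>?k\<^esub>"
          using G.pow_order_eq_1[of t] t k.order_mult_of[OF kfin] f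
          by (simp add: order_def Multiplicative_Group.nat_pow_mult_of)
        moreover have "p ^ f = Suc (p ^ f - 1)" using p1 by simp
        ultimately show ?thesis using t by (metis k.l_one k.nat_pow_Suc)
      qed
      \<comment> \<open>Raising the equation for \<open>t\<close> to the power
        \<open>p ^ (f - a)\<close> turns its left side into \<open>t\<close> itself, the field
        having \<open>p ^ f\<close> elements.\<close>
      define m where "m = n * p ^ (f - a) - 1"
      have big: "n * p ^ (f - a) \<ge> 3" 
        using n3 p1 mult_le_mono[of 3 n 1 "p ^ (f - a)"] by simp
      then have "m > 0" by (simp add: m_def)
      moreover have "t [^]\<^bsub>?k\<^esub> m = \<one>\<^bsub>?k\<^esub>" if t: "t \<in> ?T" for t
      proof -
        have "t = t [^]\<^bsub>?k\<^esub> (p ^ a * p ^ (f - a))"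
          using full[of t] T[OF t] af by (simp add: power_add[symmetric])
        also have "\<dots> = t [^]\<^bsub>?k\<^esub> (n * p ^ (f - a))"
          using T[OF t] by (simp add: k.nat_pow_pow[symmetric])
        finally have "t [^]\<^bsub>?k\<^esub> (1::nat) = t [^]\<^bsub>?k\<^esub> (n * p ^ (f - a))" using T[OF t] by simp
        moreover have "1 \<le> n * p ^ (f - a)" using big by linarith
        ultimately show ?thesis unfolding m_def using T[OF t] pow_one by blast
      qed
      ultimately have "card ?T \<le> m" by (rule bound)
      also have "m \<le> n * p ^ (f - a)" by (simp add: m_def)
      finally have "card ?T \<le> n * p ^ (f - a)" .
      moreover have "(n * p ^ (f - a))\<^sup>2 \<le> n\<^sup>2 * p ^ d"
      proof -
        have "p ^ (2 * (f - a)) \<le> p ^ d" using False f p1 by (intro power_increasing) auto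
        then show ?thesis by (simp add: power_mult_distrib power_mult[symmetric] mult.commute)
      qed
      ultimately show ?thesis by (rule sq)
    qed
  qed
qed

text \<open>If \<open>p\<close> were invertible, \<open>n / p\<close> would already vanish in the
  ring, against \<open>char\<close>.\<close>

lemma exists_maximalideal: "\<exists>M. maximalideal M R \<and> [p] \<cdot> \<one> \<in> M"
proof -
  have "\<one> \<notin> PIdl ([p] \<cdot> \<one>)"
  proof
    assume "\<one> \<in> PIdl ([p] \<cdot> \<one>)"
    then obtain x where x: "x \<in> carrier R" "\<one> = x \<otimes> [p] \<cdot> \<one>" by (auto simp: cgenideal_def)
    obtain c where c: "n = p * c" using p_dvd by blast
    have "[c] \<cdot> \<one> = (x \<otimes> [p] \<cdot> \<one>) \<otimes> [c] \<cdot> \<one>" using x(2) by simp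
    also have "\<dots> = x \<otimes> [n] \<cdot> \<one>" using x(1) by (simp add: m_assoc c add_pow_mult_one)
    also have "[n] \<cdot> \<one> = \<zero>" by (simp add: char)
    finally have "n dvd c" using x(1) char by simp
    then show False using c n3 prime_gt_1_nat[OF p]
      by (metis dvd_imp_le mult_eq_0_iff nat_mult_le_cancel_disj not_le gr0I mult.commute nat_mult_1 not_numeral_le_zero)
  qed
  then show ?thesis using maximalideal_containing[OF fin p_ideal] cgenideal_self[of "[p] \<cdot> \<one>"] by auto
qed

text \<open>\<open>card_eigen_lift\<close> passes to solutions modulo \<open>Q\<close>,
  \<open>card_units_mod_prime_power\<close> bounds the units there from below, and
  \<open>card_mod_eigen\<close> with \<open>residue_eigen_bound\<close> the solutions from
  above.\<close>

lemma density_le: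
  "real (card {x \<in> Units R. \<sigma> x = x [^] n}) * (real p ^ (v * d) * (1 - 1 / real p) ^ d)
     \<le> real (card (Units R)) * (real n * real p powr (real d / 2))"
proof -
  obtain M where M: "maximalideal M R" "[p] \<cdot> \<one> \<in> M" using exists_maximalideal by blast
  have I: "ideal M R" using M by (simp add: maximalideal.axioms(1))
  have one: "\<one> \<notin> M"
    using ideal.one_imp_carrier[OF I] maximalideal.I_notcarr[OF M(1)] by auto
  have p0: "real p > 0" using prime_gt_0_nat[OF p] by simp
  define K where "K = real (card {x \<in> Units R. \<sigma> x = x [^] n})"
  define U where "U = real (card (Units R))"
  define T where "T = real (card ((+>) M ` mod_eigen))"
  define c where "c = real (card Q)"
  have "real ((card ((+>) M ` mod_eigen))\<^sup>2) \<le> real (n\<^sup>2 * p ^ d)"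
    using residue_eigen_bound[OF M] by (rule of_nat_mono)
  then have "T\<^sup>2 \<le> (real n * real p powr (real d / 2))\<^sup>2"
    using p0 by (simp add: T_def power_mult_distrib powr_power powr_realpow)
  then have T: "T \<le> real n * real p powr (real d / 2)"
    by (rule power2_le_imp_le) simp
  have cardQ: "real (card (carrier R)) = c * real p ^ (v * d)"
    using arg_cong[OF card_ideal[OF q_dvd], of real] by (simp add: c_def power_mult)
  have "card (carrier R) > 0" using fin one_closed card_gt_0_iff by blast
  then have c0: "c > 0" using cardQ by (metis c_def less_eq_real_def mult_eq_0_iff of_nat_0_le_iff of_nat_0_less_iff less_irrefl)
  have "c * real p ^ (v * d) * (1 - 1 / real p) ^ d \<le> real (card mod_units)"
    using card_units_mod_prime_power[OF fin p, of d v] card_p_ideal(1)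
    unfolding cardQ[symmetric] mod_units_def by simp
  then have "K * (c * real p ^ (v * d) * (1 - 1 / real p) ^ d) \<le> K * real (card mod_units)"
    by (rule mult_left_mono) (simp add: K_def)
  also have "\<dots> \<le> U * real (card mod_eigen)"
    unfolding K_def U_def using of_nat_mono[OF card_eigen_lift, where 'a = real] by simp
  also have "real (card mod_eigen) \<le> T * c"
    using of_nat_mono[OF card_mod_eigen[OF I one M(2)], where 'a = real] by (simp add: T_def c_def)
  then have "U * real (card mod_eigen) \<le> U * (T * c)"
    by (rule mult_left_mono) (simp add: U_def)
  also have "\<dots> \<le> U * ((real n * real p powr (real d / 2)) * c)"
    using T c0 by (intro mult_left_mono mult_right_mono) (auto simp: U_def)
  finally have "c * (K * (real p ^ (v * d) * (1 - 1 / real p) ^ d))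
      \<le> c * (U * (real n * real p powr (real d / 2)))"
    by (simp add: mult_ac)
  then show ?thesis using c0 by (simp add: K_def U_def)
qed

end

section \<open>The density bound\<close>

text \<open>The factor \<open>(1 - 1 / p) ^ d\<close> is absorbed by \<open>p powr (2 * v * d / B)\<close> since
  \<open>- ln (1 - 1 / p) \<le> 1 / (p - 1) \<le> 2 * ln p / p\<close> for \<open>p \<ge> 3\<close>.\<close>

lemma powr_bound:
  fixes A B \<mu> :: real and n d p v :: nat
  assumes A: "A > 2" and B: "B \<ge> 3" and pB: "real p \<ge> B" and n: "n \<ge> 3" and v: "v \<ge> 1" and d: "d > 0"
    and big: "real v * ln (real p) \<ge> A * ln (real n) / real d"
    and \<mu>: "\<mu> * (real p ^ (v * d) * (1 - 1 / real p) ^ d) \<le> real n * real p powr (real d / 2)"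
  shows "\<mu> \<le> real p powr (- (real v * real d / 2) * (1 - 2 / A - 4 / B))"
proof -
  define P where "P = real p"
  define L where "L = ln P"
  have P3: "P \<ge> 3" using B pB by (simp add: P_def)
  have L1: "L \<ge> 1"
  proof -
    have "exp 1 \<le> P" using exp_le P3 by linarith
    then show ?thesis using P3 by (simp add: L_def ln_ge_iff)
  qed
  have "- ln (1 - 1 / P) = ln (P / (P - 1))"
    using P3 by (simp add: ln_div[symmetric] field_simps ln_inverse[symmetric] flip: ln_inverse)
  also have "\<dots> \<le> P / (P - 1) - 1" using P3 by (intro ln_le_minus_one) auto
  also have "\<dots> = 1 / (P - 1)" using P3 by (simp add: field_simps)
  also have "\<dots> \<le> 2 / P" using P3 by (simp add: field_simps)
  also have "\<dots> \<le> 2 / B" using B pB by (intro divide_left_mono) (auto simp: P_def)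
  also have "\<dots> \<le> 2 / B * L" using L1 B by (simp add: field_simps)
  also have "\<dots> \<le> real v * (2 / B * L)"
    using mult_right_mono[of 1 "real v" "2 / B * L"] L1 B v by simp
  finally have l1: "- ln (1 - 1 / P) \<le> real v * (2 / B * L)" .
  have l2: "ln (real n) \<le> real v * real d * L / A"
    using big d A by (simp add: field_simps P_def L_def)
  \<comment> \<open>\<open>v \<ge> 1\<close> bounds the contribution \<open>d / 2\<close> of the
    residue field by \<open>v * d / 2\<close>, so half of the exponent \<open>v * d\<close> is
    left.\<close>
  have l3: "real d / 2 * L - real (v * d) * L \<le> - (real v * real d / 2) * L"
  proof -
    have "real d * L \<le> real v * (real d * L)" 
      using mult_right_mono[of 1 "real v" "real d * L"] v L1 by simp
    then show ?thesis by (simp add: field_simps)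
  qed
  define D where "D = P ^ (v * d) * (1 - 1 / P) ^ d"
  have D0: "D > 0" using P3 by (auto simp: D_def field_simps)
  have "\<mu> \<le> real n * P powr (real d / 2) / D"
    using \<mu> D0 by (simp add: field_simps D_def P_def)
  also have "\<dots> = exp (ln (real n) + real d / 2 * L - (real (v * d) * L + real d * ln (1 - 1 / P)))"
  proof -
    have "ln D = real (v * d) * L + real d * ln (1 - 1 / P)"
    proof -
      have pos: "1 - 1 / P > 0" using P3 by simp
      then have "P ^ (v * d) > 0" "(1 - 1 / P) ^ d > 0" using P3 by auto
      then have "ln D = ln (P ^ (v * d)) + ln ((1 - 1 / P) ^ d)"
        unfolding D_def using P3 by (simp add: ln_mult)
      also have "\<dots> = real (v * d) * L + real d * ln (1 - 1 / P)"
        using pos P3 by (simp add: ln_realpow L_def)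
      finally show ?thesis .
    qed
    then have "D = exp (real (v * d) * L + real d * ln (1 - 1 / P))" using D0 by (metis exp_ln)
    moreover have "real n = exp (ln (real n))" using n by simp
    moreover have "P powr (real d / 2) = exp (real d / 2 * L)" using P3 by (simp add: powr_def L_def)
    ultimately show ?thesis by (simp add: exp_add exp_diff)
  qed
  also have "\<dots> \<le> exp (- (real v * real d / 2) * (1 - 2 / A - 4 / B) * L)"
  proof -
    have "- (real d * ln (1 - 1 / P)) \<le> real d * (real v * (2 / B * L))"
      using mult_left_mono[OF l1, of "real d"] by simp
    then have "ln (real n) + real d / 2 * L - (real (v * d) * L + real d * ln (1 - 1 / P))
        \<le> real v * real d * L / A + (- (real v * real d / 2) * L) + real d * (real v * (2 / B * L))"
      using l2 l3 by linarith
    \<comment> \<open>Factoring out \<open>v * d / 2\<close> doubles \<open>1 / A\<close> and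
      \<open>2 / B\<close>, whence the constants \<open>2 / A\<close> and
      \<open>4 / B\<close>.\<close>
    also have "\<dots> = - (real v * real d / 2) * (1 - 2 / A - 4 / B) * L"
      using A B by (simp add: field_simps)
    finally show ?thesis by simp
  qed
  also have "\<dots> = P powr (- (real v * real d / 2) * (1 - 2 / A - 4 / B))"
    using P3 by (simp add: powr_def L_def)
  finally show ?thesis by (simp add: P_def)
qed

section \<open>Reading the module structure in terms of integer multiples\<close>

lemma add_pow_eq_smult:
  fixes S :: "(int, 's, 'k) module_scheme" and n :: nat
  assumes alg: "Module.algebra (residue_ring (int n)) S" and n: "n > 1" and x: "x \<in> carrier S"
  shows "[(k::nat)] \<cdot>\<^bsub>S\<^esub> x = int (k mod n) \<odot>\<^bsub>S\<^esub> x"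
proof (induction k)
  case 0
  interpret Module.algebra "residue_ring (int n)" S by (rule alg)
  show ?case using smult_l_null[OF x] by (simp add: residue_ring_def)
next
  case (Suc k)
  interpret Module.algebra "residue_ring (int n)" S by (rule alg)
  have "[(Suc k)] \<cdot>\<^bsub>S\<^esub> x = int (k mod n) \<odot>\<^bsub>S\<^esub> x \<oplus>\<^bsub>S\<^esub> \<one>\<^bsub>residue_ring (int n)\<^esub> \<odot>\<^bsub>S\<^esub> x"
    using Suc x smult_one[OF x] by simp
  also have "\<dots> = (int (k mod n) \<oplus>\<^bsub>residue_ring (int n)\<^esub> \<one>\<^bsub>residue_ring (int n)\<^esub>) \<odot>\<^bsub>S\<^esub> x"
    using x n by (intro smult_l_distr[symmetric]) (auto simp: residue_ring_def)
  also have "int (k mod n) \<oplus>\<^bsub>residue_ring (int n)\<^esub> \<one>\<^bsub>residue_ring (int n)\<^esub> = int (Suc k mod n)"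
    by (simp add: residue_ring_def zmod_int mod_simps add.commute)
  finally show ?case .
qed

text \<open>In coordinates, the ideal generated by \<open>m\<close> consists of the vectors whose
  entries are all multiples of \<open>m\<close>, and each entry has \<open>n / m\<close> such
  values.\<close>

lemma free_finite_card_ideal:
  fixes S :: "(int, 's, 'k) module_scheme" and n d :: nat
  assumes alg: "Module.algebra (residue_ring (int n)) S" and n: "n > 1"
    and free: "free_of_rank (residue_ring (int n)) S d" and m: "m dvd n"
  shows "finite (carrier S)"
    and "card (PIdl\<^bsub>S\<^esub> ([(m::nat)] \<cdot>\<^bsub>S\<^esub> \<one>\<^bsub>S\<^esub>)) * m ^ d = card (carrier S)"
proof -
  interpret S: Module.algebra "residue_ring (int n)" S by (rule alg)
  have car: "carrier (residue_ring (int n)) = {0..int n - 1}" by (simp add: residue_ring_def)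
  from free[unfolded free_of_rank_def car] obtain b where b: "b \<in> {..<d} \<rightarrow> carrier S"
    and uniq: "\<forall>x\<in>carrier S. \<exists>!a. a \<in> {..<d} \<rightarrow>\<^sub>E {0..int n - 1} \<and>
        x = (\<Oplus>\<^bsub>S\<^esub>i\<in>{..<d}. a i \<odot>\<^bsub>S\<^esub> b i)"
    by (rule bexE)
  define comb where "comb a = (\<Oplus>\<^bsub>S\<^esub>i\<in>{..<d}. a i \<odot>\<^bsub>S\<^esub> b i)" for a
  let ?F = "{..<d} \<rightarrow>\<^sub>E {0..int n - 1}"
  have sm: "z \<odot>\<^bsub>S\<^esub> b i = [(nat z)] \<cdot>\<^bsub>S\<^esub> b i" if "z \<in> {0..int n - 1}" "i < d" for z i
  proof -
    have "b i \<in> carrier S" using b that by auto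
    then show ?thesis using that add_pow_eq_smult[OF alg n, of "b i" "nat z"] by (simp add: nat_less_iff)
  qed
  have summand: "a i \<odot>\<^bsub>S\<^esub> b i \<in> carrier S" if "a \<in> ?F" "i < d" for a i
  proof -
    have "a i \<in> {0..int n - 1}" "b i \<in> carrier S" using that b by auto
    then show ?thesis using car by simp
  qed
  have comb_closed: "comb a \<in> carrier S" if "a \<in> ?F" for a
    unfolding comb_def using summand[OF that] by (intro S.finsum_closed) auto
  have bij: "bij_betw comb ?F (carrier S)"
  proof (rule bij_betwI')
    fix a a' assume aa: "a \<in> ?F" "a' \<in> ?F"
    show "(comb a = comb a') = (a = a')"
      using bspec[OF uniq comb_closed[OF aa(1)]] aa unfolding comb_def by blast
  next
    fix x assume "x \<in> carrier S"
    from bspec[OF uniq this] show "\<exists>a\<in>?F. x = comb a" unfolding comb_def by blast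
  qed (rule comb_closed)
  have finF: "finite ?F" by (intro finite_PiE) auto
  show "finite (carrier S)" using bij finF bij_betw_finite by blast
  have "card (carrier S) = card ?F" using bij_betw_same_card[OF bij] by simp
  then have cardS: "card (carrier S) = n ^ d" by (simp add: card_PiE)
  obtain n' where n': "n = m * n'" using m by blast
  have m0: "m > 0" and n0: "n' > 0" using n' n by (auto intro!: gr0I)
  define Z where "Z = (\<lambda>z. int m * z) ` {0..<int n'}"
  have "Z \<subseteq> {0..int n - 1}"
  proof
    fix z assume "z \<in> Z"
    then obtain y where y: "z = int m * y" "0 \<le> y" "y + 1 \<le> int n'"
      unfolding Z_def by (metis atLeastLessThan_iff imageE zless_imp_add1_zle)
    have "int m * (y + 1) \<le> int m * int n'" using y by (intro mult_left_mono) auto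
    then show "z \<in> {0..int n - 1}" using y m0 by (simp add: n' algebra_simps)
  qed
  then have Fm: "({..<d} \<rightarrow>\<^sub>E Z) \<subseteq> ?F" by (intro PiE_mono) auto
  have "comb ` ({..<d} \<rightarrow>\<^sub>E Z) = PIdl\<^bsub>S\<^esub> ([m] \<cdot>\<^bsub>S\<^esub> \<one>\<^bsub>S\<^esub>)"
  proof
    have mulm: "x \<otimes>\<^bsub>S\<^esub> [m] \<cdot>\<^bsub>S\<^esub> \<one>\<^bsub>S\<^esub> = [m] \<cdot>\<^bsub>S\<^esub> x" if "x \<in> carrier S" for x
      using that by (simp add: S.add_pow_rdistr)
    \<comment> \<open>Multiplication by \<open>m\<close> acts on coordinates as multiplication by
      \<open>m\<close> modulo \<open>n\<close>.\<close>
    have key: "comb a \<otimes>\<^bsub>S\<^esub> [m] \<cdot>\<^bsub>S\<^esub> \<one>\<^bsub>S\<^esub> = comb a'"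
      if a: "a \<in> ?F" and a': "a' \<in> ?F" and eq: "\<And>i. i < d \<Longrightarrow> nat (a' i) = (m * nat (a i)) mod n" for a a'
    proof -
      have "comb a \<otimes>\<^bsub>S\<^esub> [m] \<cdot>\<^bsub>S\<^esub> \<one>\<^bsub>S\<^esub>
          = (\<Oplus>\<^bsub>S\<^esub>i\<in>{..<d}. (a i \<odot>\<^bsub>S\<^esub> b i) \<otimes>\<^bsub>S\<^esub> [m] \<cdot>\<^bsub>S\<^esub> \<one>\<^bsub>S\<^esub>)"
        unfolding comb_def using summand[OF a] by (intro S.finsum_ldistr) auto
      also have "\<dots> = comb a'" unfolding comb_def
      proof (rule S.finsum_cong')
        show "(\<lambda>i. a' i \<odot>\<^bsub>S\<^esub> b i) \<in> {..<d} \<rightarrow> carrier S" using summand[OF a'] by auto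
        fix i assume i: "i \<in> {..<d}"
        have bi: "b i \<in> carrier S" and ai: "a i \<in> {0..int n - 1}" "a' i \<in> {0..int n - 1}"
          using i b a a' by auto
        have "(a i \<odot>\<^bsub>S\<^esub> b i) \<otimes>\<^bsub>S\<^esub> [m] \<cdot>\<^bsub>S\<^esub> \<one>\<^bsub>S\<^esub> = [m] \<cdot>\<^bsub>S\<^esub> ([(nat (a i))] \<cdot>\<^bsub>S\<^esub> b i)"
          using mulm[OF summand[OF a, of i]] sm[OF ai(1), of i] i by simp
        also have "\<dots> = [(m * nat (a i))] \<cdot>\<^bsub>S\<^esub> b i"
          using bi by (simp add: S.add.nat_pow_pow mult.commute)
        also have "\<dots> = int ((m * nat (a i)) mod n) \<odot>\<^bsub>S\<^esub> b i"
          by (rule add_pow_eq_smult[OF alg n bi])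
        also have "int ((m * nat (a i)) mod n) = a' i" using eq[of i] i ai by (metis atLeastAtMost_iff int_nat_eq lessThan_iff)
        finally show "(a i \<odot>\<^bsub>S\<^esub> b i) \<otimes>\<^bsub>S\<^esub> [m] \<cdot>\<^bsub>S\<^esub> \<one>\<^bsub>S\<^esub> = a' i \<odot>\<^bsub>S\<^esub> b i" .
      qed simp
      finally show ?thesis .
    qed
    show "comb ` ({..<d} \<rightarrow>\<^sub>E Z) \<subseteq> PIdl\<^bsub>S\<^esub> ([m] \<cdot>\<^bsub>S\<^esub> \<one>\<^bsub>S\<^esub>)"
    proof clarify
      fix a' assume a': "a' \<in> {..<d} \<rightarrow>\<^sub>E Z"
      define a where "a = (\<lambda>i\<in>{..<d}. a' i div int m)"
      have ai: "0 \<le> a i \<and> a i < int n' \<and> a' i = int m * a i" if "i < d" for i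
      proof -
        have "a' i \<in> Z" using a' that by auto
        then show ?thesis using that m0 by (auto simp: Z_def a_def)
      qed
      have "n' \<le> n" using m0 by (simp add: n')
      then have "int n' \<le> int n" by simp
      then have ain: "a i \<in> {0..int n - 1}" if "i < d" for i using ai[OF that] by simp
      have a: "a \<in> ?F"
      proof (rule PiE_I)
        show "a i = undefined" if "i \<notin> {..<d}" for i using that by (simp add: a_def)
      qed (use ain in simp)
      have eq: "comb a \<otimes>\<^bsub>S\<^esub> [m] \<cdot>\<^bsub>S\<^esub> \<one>\<^bsub>S\<^esub> = comb a'"
      proof (rule key[OF a])
        show a'F: "a' \<in> ?F" using a' Fm by blast
        fix i assume i: "i < d"
        have "a' i \<in> {0..int n - 1}" using PiE_mem[OF a'F] i by blast
        then have "nat (a' i) < n" by (simp add: nat_less_iff)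
        moreover have "nat (a' i) = m * nat (a i)" using ai[OF i] by (simp add: nat_mult_distrib)
        ultimately show "nat (a' i) = (m * nat (a i)) mod n" by simp
      qed
      show "comb a' \<in> PIdl\<^bsub>S\<^esub> ([m] \<cdot>\<^bsub>S\<^esub> \<one>\<^bsub>S\<^esub>)"
        using comb_closed[OF a] unfolding cgenideal_def eq[symmetric] by blast
    qed
    show "PIdl\<^bsub>S\<^esub> ([m] \<cdot>\<^bsub>S\<^esub> \<one>\<^bsub>S\<^esub>) \<subseteq> comb ` ({..<d} \<rightarrow>\<^sub>E Z)"
    proof
      fix y assume "y \<in> PIdl\<^bsub>S\<^esub> ([m] \<cdot>\<^bsub>S\<^esub> \<one>\<^bsub>S\<^esub>)"
      then obtain x where x: "x \<in> carrier S" "y = x \<otimes>\<^bsub>S\<^esub> [m] \<cdot>\<^bsub>S\<^esub> \<one>\<^bsub>S\<^esub>"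
        by (auto simp: cgenideal_def)
      have "x \<in> comb ` ?F" using x(1) by (simp only: bij_betw_imp_surj_on[OF bij])
      then obtain a where xa: "x = comb a" and a: "a \<in> ?F" by (rule imageE)
      \<comment> \<open>Because \<open>n = m * n'\<close>, reducing \<open>m * a i\<close> modulo
        \<open>n\<close> amounts to reducing \<open>a i\<close> modulo \<open>n'\<close>; in this
        form the entry visibly lies in \<open>Z\<close>.\<close>
      define a' where "a' = (\<lambda>i\<in>{..<d}. int m * (a i mod int n'))"
      have a'Z: "a' \<in> {..<d} \<rightarrow>\<^sub>E Z"
      proof (rule PiE_I)
        show "a' i \<in> Z" if "i \<in> {..<d}" for i 
          using that n0 by (auto simp: a'_def Z_def intro!: imageI)
        show "a' i = undefined" if "i \<notin> {..<d}" for i using that by (simp add: a'_def)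
      qed
      have "y = comb a'" unfolding x(2) xa
      proof (rule key[OF a])
        show "a' \<in> ?F" using a'Z Fm by blast
        fix i assume i: "i < d"
        have "a i \<in> {0..int n - 1}" using PiE_mem[OF a] i by blast
        then have "a i \<ge> 0" by simp
        then have "nat (a' i) = m * (nat (a i) mod n')"
          using i by (simp add: a'_def nat_mult_distrib nat_mod_distrib)
        then show "nat (a' i) = (m * nat (a i)) mod n" by (simp add: n')
      qed
      then show "y \<in> comb ` ({..<d} \<rightarrow>\<^sub>E Z)" using a'Z by blast
    qed
  qed
  moreover have "inj_on comb ({..<d} \<rightarrow>\<^sub>E Z)"
    by (rule inj_on_subset[OF bij_betw_imp_inj_on[OF bij] Fm])
  ultimately have "card (PIdl\<^bsub>S\<^esub> ([m] \<cdot>\<^bsub>S\<^esub> \<one>\<^bsub>S\<^esub>)) = card ({..<d} \<rightarrow>\<^sub>E Z)"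
    by (metis card_image)
  also have "\<dots> = card Z ^ d" by (simp add: card_PiE)
  also have "card Z = n'"
    unfolding Z_def using m0 by (subst card_image) (auto simp: inj_on_def)
  finally show "card (PIdl\<^bsub>S\<^esub> ([m] \<cdot>\<^bsub>S\<^esub> \<one>\<^bsub>S\<^esub>)) * m ^ d = card (carrier S)"
    by (simp add: cardS n' power_mult_distrib mult.commute)
qed

text \<open>Fixing \<open>x\<close> passes to compositions and inverses. This turns fixed points of
  the generator into invariants of the whole Galois group.\<close>

lemma generate_fixes:
  assumes \<sigma>: "\<sigma> \<in> Bij C" and x: "x \<in> C" "\<sigma> x = x"
    and \<tau>: "\<tau> \<in> generate (BijGroup C) {\<sigma>}"
  shows "\<tau> x = x"
proof -
  interpret group "BijGroup C" by (rule group_BijGroup)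
  have car: "carrier (BijGroup C) = Bij C" by (simp add: BijGroup_def)
  show ?thesis using \<tau>
  proof (induction rule: generate.induct)
    case one
    show ?case using x by (simp add: BijGroup_def)
  next
    case (incl h)
    then show ?case using x by simp
  next
    case (inv h)
    have "inj_on \<sigma> C" using \<sigma> by (simp add: Bij_def bij_betw_def)
    then have "inv_into C \<sigma> x = x" using x inv_into_f_f by fastforce
    then show ?case using inv \<sigma> x by (simp add: inv_BijGroup)
  next
    case (eng h1 h2)
    have "h1 \<in> Bij C" "h2 \<in> Bij C"
      using eng.hyps generate_in_carrier[of "{\<sigma>}"] \<sigma> by (auto simp: car)
    then show ?case using eng.IH x by (simp add: BijGroup_def compose_def)
  qed
qed

text \<open>For negative \<open>1 - 2 / A - 4 / B\<close> the comparison of the two powers goes in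
  the opposite direction, so it carries a sign condition. The bound by a power of \<open>n\<close>
  is unconditional because its right side is then at least \<open>1\<close>.\<close>

theorem theorem3:
  fixes A B :: real
    and n d p v :: nat
    and S :: "(int, 's, 'k) module_scheme"
    and G :: "('s \<Rightarrow> 's) set"
    and \<sigma> :: "'s \<Rightarrow> 's"
  assumes "A > 2" and "B \<ge> 3"
    and "n \<ge> 3"
    and "\<And>q. prime q \<Longrightarrow> q dvd n \<Longrightarrow> real q \<ge> B"
    and "\<not> primepow n"
    and "cyclic_extension (residue_ring (int n)) S G"
    and "free_of_rank (residue_ring (int n)) S d"
    and "\<sigma> \<in> G" and "generate (BijGroup (carrier S)) {\<sigma>} = G"
    and "prime p" and "v \<ge> 1" and "p ^ v dvd n"
    and "real v * ln (real p) \<ge> A * ln (real n) / real d"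
  shows "power_density S \<sigma> n
           \<le> real p powr (- (real v * real d / 2) * (1 - 2 / A - 4 / B)) \<and>
         (0 \<le> 1 - 2 / A - 4 / B \<longrightarrow>
           real p powr (- (real v * real d / 2) * (1 - 2 / A - 4 / B))
           \<le> real n powr (- (A / 2) * (1 - 2 / A - 4 / B))) \<and>
         power_density S \<sigma> n
           \<le> real n powr (- (A / 2) * (1 - 2 / A - 4 / B))"
proof -
  have gal: "galois_extension (residue_ring (int n)) S G"
    using assms(6) by (simp add: cyclic_extension_def)
  then have alg: "Module.algebra (residue_ring (int n)) S"
    and auts: "G \<subseteq> algebra_auts (residue_ring (int n)) S"
    and inv: "bij_betw (\<lambda>r. r \<odot>\<^bsub>S\<^esub> \<one>\<^bsub>S\<^esub>) (carrier (residue_ring (int n))) (invariants S G)"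
    unfolding galois_extension_def by blast+
  interpret S: Module.algebra "residue_ring (int n)" S by (rule alg)
  have n1: "n > 1" using assms(3) by simp
  have \<sigma>: "\<sigma> \<in> Bij (carrier S)" "\<sigma> \<in> ring_hom S S"
    using assms(8) auts by (auto simp: algebra_auts_def)
  have car: "carrier (residue_ring (int n)) = {0..int n - 1}" by (simp add: residue_ring_def)
  have smult: "[(k::nat)] \<cdot>\<^bsub>S\<^esub> \<one>\<^bsub>S\<^esub> = int (k mod n) \<odot>\<^bsub>S\<^esub> \<one>\<^bsub>S\<^esub>" for k
    by (rule add_pow_eq_smult[OF alg n1 S.one_closed])
  have char: "[(r::nat)] \<cdot>\<^bsub>S\<^esub> \<one>\<^bsub>S\<^esub> = \<zero>\<^bsub>S\<^esub> \<longleftrightarrow> n dvd r" for r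
  proof -
    have "0 \<odot>\<^bsub>S\<^esub> \<one>\<^bsub>S\<^esub> = \<zero>\<^bsub>S\<^esub>"
      using smult[of 0] by simp
    then have "[r] \<cdot>\<^bsub>S\<^esub> \<one>\<^bsub>S\<^esub> = \<zero>\<^bsub>S\<^esub> \<longleftrightarrow> int (r mod n) \<odot>\<^bsub>S\<^esub> \<one>\<^bsub>S\<^esub> = 0 \<odot>\<^bsub>S\<^esub> \<one>\<^bsub>S\<^esub>"
      using smult[of r] by simp
    also have "\<dots> \<longleftrightarrow> int (r mod n) = 0"
      using inj_on_eq_iff[OF bij_betw_imp_inj_on[OF inv], of "int (r mod n)" 0] n1 by (simp add: car)
    finally show ?thesis by (simp add: dvd_eq_mod_eq_0)
  qed
  have fixed: "\<exists>r::nat. x = [r] \<cdot>\<^bsub>S\<^esub> \<one>\<^bsub>S\<^esub>" if x: "x \<in> carrier S" "\<sigma> x = x" for x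
  proof -
    have "x \<in> invariants S G"
      using generate_fixes[OF \<sigma>(1) x] x assms(9) by (auto simp: invariants_def)
    then have "x \<in> (\<lambda>r. r \<odot>\<^bsub>S\<^esub> \<one>\<^bsub>S\<^esub>) ` {0..int n - 1}"
      using bij_betw_imp_surj_on[OF inv] by (simp add: car)
    then obtain r where r: "x = r \<odot>\<^bsub>S\<^esub> \<one>\<^bsub>S\<^esub>" "r \<in> {0..int n - 1}" by (rule imageE)
    then have "x = [(nat r)] \<cdot>\<^bsub>S\<^esub> \<one>\<^bsub>S\<^esub>" using smult[of "nat r"] by (simp add: nat_less_iff)
    then show ?thesis ..
  qed
  interpret C: cyclic_algebra_mod S \<sigma> n d p v
  proof
    show "finite (carrier S)" using free_finite_card_ideal(1)[OF alg n1 assms(7) dvd_refl] .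
    show "\<sigma> \<in> ring_hom S S" by (rule \<sigma>(2))
    show "bij_betw \<sigma> (carrier S) (carrier S)" using \<sigma>(1) by (simp add: Bij_def)
    show "card (PIdl\<^bsub>S\<^esub> ([m] \<cdot>\<^bsub>S\<^esub> \<one>\<^bsub>S\<^esub>)) * m ^ d = card (carrier S)" if "m dvd n" for m :: nat
      by (rule free_finite_card_ideal(2)[OF alg n1 assms(7) that])
  qed (use assms fixed char in auto)
  \<comment> \<open>For \<open>d = 0\<close>, \<open>card_ideal\<close> with \<open>m = n\<close>
    would give the zero ideal as many elements as the ring, which has at least two.\<close>
  have d: "d > 0"
  proof (rule gr0I)
    assume "d = 0"
    then have "card (PIdl\<^bsub>S\<^esub> ([n] \<cdot>\<^bsub>S\<^esub> \<one>\<^bsub>S\<^esub>)) = card (carrier S)"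
      using C.card_ideal[of n] by simp
    moreover have "PIdl\<^bsub>S\<^esub> ([n] \<cdot>\<^bsub>S\<^esub> \<one>\<^bsub>S\<^esub>) \<subseteq> {\<zero>\<^bsub>S\<^esub>}"
      using char[of n] by (auto simp: cgenideal_def)
    then have "card (PIdl\<^bsub>S\<^esub> ([n] \<cdot>\<^bsub>S\<^esub> \<one>\<^bsub>S\<^esub>)) \<le> card {\<zero>\<^bsub>S\<^esub>}" by (intro card_mono) auto
    moreover have "\<one>\<^bsub>S\<^esub> \<noteq> \<zero>\<^bsub>S\<^esub>" using char[of 1] n1 by simp
    then have "card {\<zero>\<^bsub>S\<^esub>, \<one>\<^bsub>S\<^esub>} = 2" by simp
    moreover have "card {\<zero>\<^bsub>S\<^esub>, \<one>\<^bsub>S\<^esub>} \<le> card (carrier S)" using C.fin by (intro card_mono) auto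
    ultimately show False by simp
  qed
  define \<mu> where "\<mu> = power_density S \<sigma> n"
  define c where "c = 1 - 2 / A - 4 / B"
  have finU: "finite (Units S)" using C.fin by (auto intro: finite_subset[of _ "carrier S"])
  then have U: "card (Units S) > 0" using S.Units_one_closed card_gt_0_iff by blast
  have "card {x \<in> Units S. \<sigma> x = x [^]\<^bsub>S\<^esub> n} \<le> card (Units S)" using finU by (intro card_mono) auto
  then have \<mu>1: "\<mu> \<le> 1" using U by (simp add: \<mu>_def power_density_def)
  have "\<mu> * (real p ^ (v * d) * (1 - 1 / real p) ^ d) \<le> real n * real p powr (real d / 2)"
    using C.density_le U by (simp add: \<mu>_def power_density_def field_simps)
  moreover have "real p \<ge> B" using assms(4)[OF assms(10) C.p_dvd] .
  ultimately have b1: "\<mu> \<le> real p powr (- (real v * real d / 2) * c)"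
    unfolding c_def using assms d by (intro powr_bound) auto
  have b2: "real p powr (- (real v * real d / 2) * c) \<le> real n powr (- (A / 2) * c)" if "0 \<le> c"
  proof -
    have "A * ln (real n) \<le> real v * real d * ln (real p)"
      using assms(13) d by (simp add: field_simps)
    then have "c / 2 * (A * ln (real n)) \<le> c / 2 * (real v * real d * ln (real p))"
      using that by (intro mult_left_mono) auto
    then have "- (real v * real d / 2) * c * ln (real p) \<le> - (A / 2) * c * ln (real n)"
      by (simp add: mult_ac)
    moreover have "p > 0" using assms(10) prime_gt_0_nat by blast
    ultimately show ?thesis using n1 by (simp add: powr_def)
  qed
  have b3: "\<mu> \<le> real n powr (- (A / 2) * c)"
  proof (cases "0 \<le> c")
    case True
    then show ?thesis using b1 b2 by linarith
  next
    case False
    then have "0 \<le> - (A / 2) * c" using assms(1) by (simp add: mult_nonneg_nonpos)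
    then have "1 \<le> real n powr (- (A / 2) * c)" using n1 by (intro ge_one_powr_ge_zero) auto
    then show ?thesis using \<mu>1 by linarith
  qed
  show ?thesis using b1 b2 b3 unfolding \<mu>_def c_def by blast
qed

end
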